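(* Let $I\subset\mathbb{N}$, $\overline J\subset\overline{\mathbb{N}}$ be nonempty finite subsets with $\min(I\sqcup\overline J)\in I$, $\max(I\sqcup\overline J)\in\overline J$, and let $\nu=\nu(I,\overline J)$. For $(I,\overline J)$-trees $T,T'$, the tree $T'$ is obtained from $T$ by an increasing flip if and only if $\rho(T')$ is obtained from $\rho(T)$ by a $\nu$-Tamari move (i.e. $\rho(T)\lessdot_\nu\rho(T')$). Consequently, the $(I,\overline J)$-Tamari poset is isomorphic to the $\nu$-Tamari poset via $\rho$.
   Context: $\mathbb{N}=\{0,1,\dots\}$, $\overline{\mathbb{N}}$ a disjoint copy, totally ordered by $i\prec\overline i\prec i+1$. An $(I,\overline J)$-forest is a subgraph of the complete bipartite graph $K_{I,\overline J}$ all of whose arcs $(i,\overline j)$ satisfy $i\le j$ and containing no two arcs $(i,\overline j),(i',\overline{j'})$ with $i<i'\le j<j'$; an $(I,\overline J)$-tree is a maximal one. Two trees $T,T'$ are related by a flip if $T'=(T\setminus\{(i,\overline j)\})\cup\{(i',\overline{j'})\}$ with $(i,\overline j)\ne(i',\overline{j'})$; the flip is increasing if $i'>i$ and $j'>j$. The $(I,\overline J)$-Tamari poset is the transitive closure of the relation "$T'$ is obtained from $T$ by an increasing flip". Lattice paths are words in $\mathsf N,\mathsf E$ starting at $(0,0)$. $\nu(I,\overline J)$ is the path from $(0,0)$ to $(|I|-1,|\overline J|-1)$ whose $k$-th step is $\mathsf E$ if the $(k+1)$-st element of $I\sqcup\overline J$ (in $\prec$-order) lies in $I$ and $\mathsf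 N$ otherwise. For a tree $T$ with $\overline J=\{\overline j_1\prec\dots\prec\overline j_k\}$, $\rho(T)=\mathsf E^{d_T(\overline j_1)-1}\mathsf N\mathsf E^{d_T(\overline j_2)-1}\mathsf N\cdots\mathsf N\mathsf E^{d_T(\overline j_k)-1}$ with $d_T$ the degree in $T$. A $\nu$-Dyck path is a lattice path with the same endpoint as $\nu$ lying weakly above $\nu$. For a $\nu$-Dyck path $\mu$ and a lattice point $p$ on $\mu$, $\mathrm{horiz}_\nu(p)$ is the maximal number of east steps that can be appended to the right of $p$ without crossing (going strictly below) $\nu$. A valley of $\mu$ is a lattice point preceded by an $\mathsf E$ step and followed by an $\mathsf N$ step. For a valley $p$, let $q$ be the first lattice point of $\mu$ after $p$ with $\mathrm{horiz}_\nu(q)=\mathrm{horiz}_\nu(p)$, and let $\mu'$ be obtained from $\mu$ by exchanging the $\mathsf E$ step immediately preceding $p$ with the subpath $\mu_{[p,q]}$ of $\mu$ from $p$ to $q$; this is a $\nu$-Tamari move, written $\mu\lessdot_\nu\mu'$. The $\nu$-Tamari poset is the transitive closure of these moves on the set of $\nu$-Dyck paths. *)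

theory Defs
  imports Main
begin

section \<open>Vertices, forests and trees\<close>

text \<open>
  The disjoint union of the naturals and their barred copy. The key realises the total order
  in which \<open>Bar i\<close> is the immediate successor of \<open>Plain i\<close>, and \<open>Plain (i + 1)\<close> that of \<open>Bar i\<close>.
\<close>

datatype vertex = Plain nat | Bar nat

fun vertex_key :: "vertex \<Rightarrow> nat" where
  "vertex_key (Plain i) = 2 * i"
| "vertex_key (Bar i) = 2 * i + 1"

lemma vertex_key_inject: "vertex_key u = vertex_key v \<Longrightarrow> u = v"
  by (cases u; cases v) (auto, presburger+)

instantiation vertex :: linorder
begin

definition less_eq_vertex :: "vertex \<Rightarrow> vertex \<Rightarrow> bool" where
  "u \<le> v \<longleftrightarrow> vertex_key u \<le> vertex_key v"

definition less_vertex :: "vertex \<Rightarrow> vertex \<Rightarrow> bool" where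
  "u < v \<longleftrightarrow> vertex_key u < vertex_key v"

instance
  by standard (auto simp: less_eq_vertex_def less_vertex_def intro: vertex_key_inject)

end

lemma vertex_order:
  "Plain i < Bar i" "Bar i < Plain (i + 1)"
  by (auto simp: less_vertex_def)

text \<open>
  A subset of the barred copy is given by the set \<open>J\<close> of its underlying numbers, and the arc
  joining \<open>Plain i\<close> to \<open>Bar j\<close> is the pair \<open>(i, j)\<close>. A subgraph of the complete bipartite graph
  is identified with its set of arcs.
\<close>

definition vertices :: "nat set \<Rightarrow> nat set \<Rightarrow> vertex set" where
  "vertices I J = Plain ` I \<union> Bar ` J"

definition IJ_forest :: "nat set \<Rightarrow> nat set \<Rightarrow> (nat \<times> nat) set \<Rightarrow> bool" where
  "IJ_forest I J F \<longleftrightarrow>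
     F \<subseteq> I \<times> J \<and>
     (\<forall>(i, j) \<in> F. i \<le> j) \<and>
     \<not> (\<exists>i j i' j'. (i, j) \<in> F \<and> (i', j') \<in> F \<and> i < i' \<and> i' \<le> j \<and> j < j')"

definition IJ_tree :: "nat set \<Rightarrow> nat set \<Rightarrow> (nat \<times> nat) set \<Rightarrow> bool" where
  "IJ_tree I J T \<longleftrightarrow>
     IJ_forest I J T \<and> (\<forall>F. IJ_forest I J F \<and> T \<subseteq> F \<longrightarrow> F = T)"

text \<open>
  The removed arc has to be an arc of \<open>T\<close>; otherwise every tree would be a flip of itself
  (remove an absent arc, add a present one).
\<close>

definition increasing_flip ::
    "nat set \<Rightarrow> nat set \<Rightarrow> (nat \<times> nat) set \<Rightarrow> (nat \<times> nat) set \<Rightarrow> bool" where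
  "increasing_flip I J T T' \<longleftrightarrow>
     IJ_tree I J T \<and> IJ_tree I J T' \<and>
     (\<exists>i j i' j'. (i, j) \<in> T \<and> (i, j) \<noteq> (i', j') \<and>
        T' = (T - {(i, j)}) \<union> {(i', j')} \<and> i' > i \<and> j' > j)"

text \<open>The order is the reflexive and transitive closure, restricted to trees.\<close>

definition IJ_Tamari_order ::
    "nat set \<Rightarrow> nat set \<Rightarrow> ((nat \<times> nat) set \<times> (nat \<times> nat) set) set" where
  "IJ_Tamari_order I J =
     {(T, T'). IJ_tree I J T \<and> IJ_tree I J T' \<and> (increasing_flip I J)\<^sup>*\<^sup>* T T'}"


section \<open>Lattice paths\<close>

datatype step = North | East

type_synonym path = "step list"

text \<open>The point reached after the first \<open>k\<close> steps of a path starting at the origin.\<close>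

definition path_point :: "path \<Rightarrow> nat \<Rightarrow> nat \<times> nat" where
  "path_point \<mu> k = (count_list (take k \<mu>) East, count_list (take k \<mu>) North)"

definition path_points :: "path \<Rightarrow> (nat \<times> nat) set" where
  "path_points \<mu> = {path_point \<mu> k | k. k \<le> length \<mu>}"

definition endpoint :: "path \<Rightarrow> nat \<times> nat" where
  "endpoint \<mu> = path_point \<mu> (length \<mu>)"

text \<open>
  Points to the right of the endpoint of \<open>\<nu>\<close> vacuously count as strictly below \<open>\<nu>\<close>, so that
  east steps along the top row cannot be continued past the endpoint.
\<close>

definition strictly_below :: "path \<Rightarrow> nat \<times> nat \<Rightarrow> bool" where
  "strictly_below \<nu> p \<longleftrightarrow> (\<forall>q \<in> path_points \<nu>. fst q = fst p \<longrightarrow> snd p < snd q)"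

definition Dyck_path :: "path \<Rightarrow> path \<Rightarrow> bool" where
  "Dyck_path \<nu> \<mu> \<longleftrightarrow>
     endpoint \<mu> = endpoint \<nu> \<and> (\<forall>p \<in> path_points \<mu>. \<not> strictly_below \<nu> p)"

definition horiz :: "path \<Rightarrow> nat \<times> nat \<Rightarrow> nat" where
  "horiz \<nu> p = Max {h. \<forall>h' \<le> h. \<not> strictly_below \<nu> (fst p + h', snd p)}"

definition valley :: "path \<Rightarrow> nat \<Rightarrow> bool" where
  "valley \<mu> k \<longleftrightarrow> 0 < k \<and> k < length \<mu> \<and> \<mu> ! (k - 1) = East \<and> \<mu> ! k = North"

text \<open>
  Here \<open>p\<close> and \<open>q\<close> are the points reached after \<open>k\<close> and \<open>l\<close> steps, so that the path from \<open>p\<close> to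
  \<open>q\<close> is \<open>take (l - k) (drop k \<mu>)\<close>.
\<close>

definition Tamari_move :: "path \<Rightarrow> path \<Rightarrow> path \<Rightarrow> bool" where
  "Tamari_move \<nu> \<mu> \<mu>' \<longleftrightarrow>
     Dyck_path \<nu> \<mu> \<and>
     (\<exists>k l. valley \<mu> k \<and> k < l \<and> l \<le> length \<mu> \<and>
        horiz \<nu> (path_point \<mu> l) = horiz \<nu> (path_point \<mu> k) \<and>
        (\<forall>m. k < m \<and> m < l \<longrightarrow> horiz \<nu> (path_point \<mu> m) \<noteq> horiz \<nu> (path_point \<mu> k)) \<and>
        \<mu>' = take (k - 1) \<mu> @ take (l - k) (drop k \<mu>) @ [East] @ drop l \<mu>)"

definition nu_Tamari_order :: "path \<Rightarrow> (path \<times> path) set" where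
  "nu_Tamari_order \<nu> =
     {(\<mu>, \<mu>'). Dyck_path \<nu> \<mu> \<and> Dyck_path \<nu> \<mu>' \<and> (Tamari_move \<nu>)\<^sup>*\<^sup>* \<mu> \<mu>'}"


section \<open>From trees to paths\<close>

fun vertex_step :: "vertex \<Rightarrow> step" where
  "vertex_step (Plain i) = East"
| "vertex_step (Bar j) = North"

text \<open>The first and the last vertex do not contribute a step.\<close>

definition nu_path :: "nat set \<Rightarrow> nat set \<Rightarrow> path" where
  "nu_path I J = map vertex_step (butlast (tl (sorted_list_of_set (vertices I J))))"

definition bar_degree :: "(nat \<times> nat) set \<Rightarrow> nat \<Rightarrow> nat" where
  "bar_degree T j = card {i. (i, j) \<in> T}"

fun join_North :: "path list \<Rightarrow> path" where
  "join_North [] = []"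
| "join_North [w] = w"
| "join_North (w # w' # ws) = w @ [North] @ join_North (w' # ws)"

text \<open>
  In a tree whose least vertex is plain and whose greatest vertex is barred, all degrees
  are positive, so the subtraction below does not truncate.
\<close>

definition rho :: "nat set \<Rightarrow> (nat \<times> nat) set \<Rightarrow> path" where
  "rho J T =
     join_North (map (\<lambda>j. replicate (bar_degree T j - 1) East) (sorted_list_of_set J))"

end

theory Submission
  imports Defs
begin

text \<open>
  Read a path while keeping a stack of vertices of \<open>I\<close>: an east step pops the stack, and a north
  step passes to the next element of \<open>J\<close> and pushes the vertices of \<open>I\<close> lying in between. A path
  is a \<open>\<nu>\<close>-Dyck path iff the stack never becomes empty and ends with one element, and \<open>horiz\<close> of a
  lattice point is the height of the stack minus one. Each lattice point yields the arc from the top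
  of the stack to the current element of \<open>J\<close>; these arcs form a tree, and every tree arises in
  this way from its image under \<open>\<rho>\<close>.

  In a Tamari move at a valley \<open>p\<close>, the stack between \<open>p\<close> and \<open>q\<close> stays strictly higher than at
  \<open>p\<close>, so delaying the east step before \<open>p\<close> changes no arc except that the arc of \<open>p\<close> is exchanged
  for an increasing one. Conversely, the arc removed by an increasing flip sits at a valley, and
  it can be exchanged in only one increasing way.
\<close>

section \<open>Crossing arcs\<close>

text \<open>Drawn above the line of all vertices, the two arcs interleave, because
  \<open>i' \<le> j\<close> says that \<open>Plain i'\<close> precedes \<open>Bar j\<close>. The
  relation is oriented, with the smaller plain end first, so compatibility of two arcs is tested in
  both orders.\<close>

fun cross :: "nat \<times> nat \<Rightarrow> nat \<times> nat \<Rightarrow> bool" where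
  "cross (i, j) (i', j') \<longleftrightarrow> i < i' \<and> i' \<le> j \<and> j < j'"

text \<open>The notion of tree relative to any ground set \<open>G\<close>, so that an induction
  along a path can shrink \<open>G\<close>. Since crossing concerns pairs, maximality is tested on
  single arcs.\<close>

definition max_noncrossing :: "(nat \<times> nat) set \<Rightarrow> (nat \<times> nat) set \<Rightarrow> bool" where
  "max_noncrossing G T \<longleftrightarrow>
     T \<subseteq> G \<and> (\<forall>p \<in> T. \<forall>q \<in> T. \<not> cross p q) \<and>
     (\<forall>p \<in> G. (\<forall>q \<in> T. \<not> cross p q \<and> \<not> cross q p) \<longrightarrow> p \<in> T)"

lemma max_noncrossingD:
  assumes "max_noncrossing G T"
  shows "T \<subseteq> G"
    and "\<And>p q. p \<in> T \<Longrightarrow> q \<in> T \<Longrightarrow> \<not> cross p q"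
    and "\<And>p. p \<in> G \<Longrightarrow> (\<And>q. q \<in> T \<Longrightarrow> \<not> cross p q \<and> \<not> cross q p) \<Longrightarrow> p \<in> T"
  using assms unfolding max_noncrossing_def by blast+

text \<open>This turns the symmetric outcome of an exchange into the form of a flip:
  \<open>a\<close> and \<open>y\<close> cross, hence differ, so \<open>y\<close> is in
  \<open>T'\<close> and \<open>a\<close> is not.\<close>

lemma exchange_eq:
  assumes "insert y T = insert a T'" "cross a y" "\<And>p q. p \<in> T' \<Longrightarrow> q \<in> T' \<Longrightarrow> \<not> cross p q"
  shows "T' = (T - {a}) \<union> {y}"
proof -
  have "a \<noteq> y" using assms(2) by (cases a; cases y) auto
  then have y: "y \<in> T'" using assms(1) by (metis insert_iff)
  then have "a \<notin> T'" using assms(2,3) by metis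
  then have "T' = insert a T' - {a}" by simp
  also have "\<dots> = insert y T - {a}" using assms(1) by simp
  also have "\<dots> = (T - {a}) \<union> {y}" using \<open>a \<noteq> y\<close> by auto
  finally show ?thesis .
qed

lemma IJ_forest_iff:
  "IJ_forest I J F \<longleftrightarrow>
     F \<subseteq> {(i, j). i \<in> I \<and> j \<in> J \<and> i \<le> j} \<and> (\<forall>p \<in> F. \<forall>q \<in> F. \<not> cross p q)"
  unfolding IJ_forest_def by fastforce

text \<open>Crossing is a condition on pairs and no arc crosses itself, so an arc compatible with
  all of \<open>T\<close> could be added to \<open>T\<close> alone.\<close>

lemma IJ_tree_iff: "IJ_tree I J T \<longleftrightarrow> max_noncrossing {(i, j). i \<in> I \<and> j \<in> J \<and> i \<le> j} T"
proof
  let ?G = "{(i, j). i \<in> I \<and> j \<in> J \<and> i \<le> j}"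
  assume T: "IJ_tree I J T"
  then have F: "IJ_forest I J T" by (simp add: IJ_tree_def)
  moreover have "p \<in> T" if "p \<in> ?G" "\<forall>q \<in> T. \<not> cross p q \<and> \<not> cross q p" for p
  proof -
    have "\<not> cross p p" by (cases p) simp
    then have "IJ_forest I J (insert p T)"
      using F that unfolding IJ_forest_iff by blast
    then show ?thesis using T unfolding IJ_tree_def by blast
  qed
  ultimately show "max_noncrossing ?G T"
    unfolding IJ_forest_iff max_noncrossing_def by blast
next
  let ?G = "{(i, j). i \<in> I \<and> j \<in> J \<and> i \<le> j}"
  assume T: "max_noncrossing ?G T"
  then show "IJ_tree I J T"
    unfolding IJ_tree_def IJ_forest_iff max_noncrossing_def by blast
qed


section \<open>The stack automaton\<close>

text \<open>
  A state consists of the stack, top first, and of the elements of \<open>J\<close> from the current one on.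
  The arc of a state is read off at the corresponding lattice point, so that a path with \<open>n\<close> steps
  has \<open>n + 1\<close> arcs; \<open>trail\<close> omits the last one.
\<close>

type_synonym state = "nat list \<times> nat list"

text \<open>The stack is listed from its largest vertex down, hence the \<open>rev\<close>.\<close>

fun advance :: "nat set \<Rightarrow> step \<Rightarrow> state \<Rightarrow> state" where
  "advance I East (s, r) = (tl s, r)"
| "advance I North (s, r) =
     (rev (sorted_list_of_set {i \<in> I. hd r < i \<and> i \<le> hd (tl r)}) @ s, tl r)"

text \<open>With two entries before the step, the stack or the list of barred vertices remains
  nonempty after it.\<close>

fun enabled :: "step \<Rightarrow> state \<Rightarrow> bool" where
  "enabled East (s, r) \<longleftrightarrow> 2 \<le> length s"
| "enabled North (s, r) \<longleftrightarrow> 2 \<le> length r"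

fun arc :: "state \<Rightarrow> nat \<times> nat" where
  "arc (s, r) = (hd s, hd r)"

fun run :: "nat set \<Rightarrow> state \<Rightarrow> path \<Rightarrow> state" where
  "run I \<sigma> [] = \<sigma>"
| "run I \<sigma> (a # u) = run I (advance I a \<sigma>) u"

fun admissible :: "nat set \<Rightarrow> state \<Rightarrow> path \<Rightarrow> bool" where
  "admissible I \<sigma> [] \<longleftrightarrow> True"
| "admissible I \<sigma> (a # u) \<longleftrightarrow> enabled a \<sigma> \<and> admissible I (advance I a \<sigma>) u"

fun trail :: "nat set \<Rightarrow> state \<Rightarrow> path \<Rightarrow> (nat \<times> nat) set" where
  "trail I \<sigma> [] = {}"
| "trail I \<sigma> (a # u) = insert (arc \<sigma>) (trail I (advance I a \<sigma>) u)"

definition arcs :: "nat set \<Rightarrow> state \<Rightarrow> path \<Rightarrow> (nat \<times> nat) set" where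
  "arcs I \<sigma> u = insert (arc (run I \<sigma> u)) (trail I \<sigma> u)"

fun final :: "state \<Rightarrow> bool" where
  "final (s, r) \<longleftrightarrow> length s = 1 \<and> length r = 1"

definition accepted :: "nat set \<Rightarrow> state \<Rightarrow> path \<Rightarrow> bool" where
  "accepted I \<sigma> u \<longleftrightarrow> admissible I \<sigma> u \<and> final (run I \<sigma> u)"

fun wf_state :: "state \<Rightarrow> bool" where
  "wf_state (s, r) \<longleftrightarrow> s \<noteq> [] \<and> r \<noteq> [] \<and> sorted_wrt (>) s \<and> sorted_wrt (<) r \<and> (\<forall>i \<in> set s. i \<le> hd r)"

text \<open>The arcs that a run from this state can still produce: plain ends are on the stack or
  yet to be pushed, and barred ends have not been passed.\<close>

fun ground :: "nat set \<Rightarrow> state \<Rightarrow> (nat \<times> nat) set" where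
  "ground I (s, r) = {(i, j). j \<in> set r \<and> i \<le> j \<and> (i \<in> set s \<or> i \<in> I \<and> hd r < i)}"

section \<open>Elementary rules for runs and their arcs\<close>

lemma arcs_simps [simp]:
  "arcs I \<sigma> [] = {arc \<sigma>}"
  "arcs I \<sigma> (a # u) = insert (arc \<sigma>) (arcs I (advance I a \<sigma>) u)"
  by (auto simp: arcs_def)

lemma accepted_simps [simp]:
  "accepted I \<sigma> [] \<longleftrightarrow> final \<sigma>"
  "accepted I \<sigma> (a # u) \<longleftrightarrow> enabled a \<sigma> \<and> accepted I (advance I a \<sigma>) u"
  by (auto simp: accepted_def)

lemma run_append [simp]: "run I \<sigma> (u @ v) = run I (run I \<sigma> u) v"
  by (induction u arbitrary: \<sigma>) auto

lemma admissible_append [simp]: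
  "admissible I \<sigma> (u @ v) \<longleftrightarrow> admissible I \<sigma> u \<and> admissible I (run I \<sigma> u) v"
  by (induction u arbitrary: \<sigma>) auto

lemma trail_append: "trail I \<sigma> (u @ v) = trail I \<sigma> u \<union> trail I (run I \<sigma> u) v"
  by (induction u arbitrary: \<sigma>) auto

lemma arcs_append: "arcs I \<sigma> (u @ v) = trail I \<sigma> u \<union> arcs I (run I \<sigma> u) v"
  by (auto simp: arcs_def trail_append)

lemma accepted_append:
  "accepted I \<sigma> (u @ v) \<longleftrightarrow> admissible I \<sigma> u \<and> accepted I (run I \<sigma> u) v"
  by (auto simp: accepted_def)

lemma arcs_conv_take: "arcs I \<sigma> u = (\<lambda>k. arc (run I \<sigma> (take k u))) ` {..length u}"
  by (induction u arbitrary: \<sigma>) (auto simp: atMost_Suc_eq_insert_0 image_image)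

lemma arc_in_arcs: "arc \<sigma> \<in> arcs I \<sigma> u"
  by (cases u) auto

lemma snd_run: "snd (run I \<sigma> u) = drop (count_list u North) (snd \<sigma>)"
proof (induction u arbitrary: \<sigma>)
  case (Cons a u)
  then show ?case by (cases a; cases \<sigma>) (auto simp: drop_Suc)
qed simp

section \<open>Invariants of a run and the arcs available to it\<close>

lemma wf_advance:
  assumes "finite I" "wf_state \<sigma>" "enabled a \<sigma>"
  shows "wf_state (advance I a \<sigma>)"
proof (cases \<sigma>)
  case (Pair s r)
  show ?thesis
  proof (cases a)
    case East
    with assms Pair obtain i i' s' where "s = i # i' # s'"
      by (cases s; cases "tl s") auto
    with assms Pair East show ?thesis by auto
  next
    case North
    with assms Pair obtain j j' r' where "r = j # j' # r'"
      by (cases r; cases "tl r") auto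
    with assms Pair North show ?thesis
      by (fastforce simp: sorted_wrt_append sorted_wrt_rev)
  qed
qed

lemma wf_run:
  "finite I \<Longrightarrow> wf_state \<sigma> \<Longrightarrow> admissible I \<sigma> u \<Longrightarrow> wf_state (run I \<sigma> u)"
  by (induction u arbitrary: \<sigma>) (simp_all add: wf_advance)

text \<open>An east step gives up the plain end of the current arc for good, a north step its barred
  end. Either way that arc is lost.\<close>

lemma ground_advance:
  assumes "finite I" "wf_state \<sigma>" "enabled a \<sigma>"
  shows "ground I (advance I a \<sigma>) \<subseteq> ground I \<sigma> - {arc \<sigma>}"
proof (cases \<sigma>)
  case (Pair s r)
  show ?thesis
  proof (cases a)
    case East
    with assms Pair obtain i i' s' where "s = i # i' # s'"
      by (cases s; cases "tl s") auto
    with assms Pair East show ?thesis by auto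
  next
    case North
    with assms Pair obtain j j' r' where "r = j # j' # r'"
      by (cases r; cases "tl r") auto
    with assms Pair North show ?thesis by auto
  qed
qed

lemma arc_in_ground: "wf_state \<sigma> \<Longrightarrow> arc \<sigma> \<in> ground I \<sigma>"
  by (cases \<sigma>) auto

text \<open>The current arc joins the largest stack vertex to the first remaining barred vertex.
  Every other available plain end is smaller or lies beyond that barred vertex, so no arc of the
  ground set interleaves with it.\<close>

lemma arc_not_cross:
  assumes "wf_state \<sigma>" "p \<in> ground I \<sigma>"
  shows "\<not> cross (arc \<sigma>) p" "\<not> cross p (arc \<sigma>)"
proof -
  obtain s r where \<sigma>: "\<sigma> = (s, r)" by (cases \<sigma>)
  with assms obtain i s' j r' where "s = i # s'" "r = j # r'"
    by (cases s; cases r) auto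
  moreover obtain b c where "p = (b, c)" by (cases p)
  ultimately show "\<not> cross (arc \<sigma>) p" "\<not> cross p (arc \<sigma>)"
    using assms \<sigma> by auto
qed

section \<open>Accepted words and maximal noncrossing sets\<close>

lemma arcs_subset_ground:
  assumes "finite I" "wf_state \<sigma>" "admissible I \<sigma> u"
  shows "arcs I \<sigma> u \<subseteq> ground I \<sigma>"
  using assms(2,3)
proof (induction u arbitrary: \<sigma>)
  case Nil
  then show ?case using arc_in_ground by simp
next
  case (Cons a u)
  then have "arcs I (advance I a \<sigma>) u \<subseteq> ground I (advance I a \<sigma>)"
    using wf_advance[OF assms(1)] by simp
  also have "\<dots> \<subseteq> ground I \<sigma>"
    using ground_advance[OF assms(1) Cons.prems(1)] Cons.prems(2) by auto
  finally show ?case using arc_in_ground[OF Cons.prems(1)] by simp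
qed

text \<open>A vertex leaves the stack only from the top, and the last state has a single vertex on
  it, so each stack vertex is on top at some moment and then has an arc.\<close>

lemma stack_vertex_has_arc:
  assumes "finite I" "wf_state \<sigma>" "accepted I \<sigma> u" "i \<in> set (fst \<sigma>)"
  shows "\<exists>j. (i, j) \<in> arcs I \<sigma> u"
  using assms(2-)
proof (induction u arbitrary: \<sigma>)
  case Nil
  then show ?case by (cases \<sigma>) (auto simp: length_Suc_conv)
next
  case (Cons a u)
  obtain s r where \<sigma>: "\<sigma> = (s, r)" by (cases \<sigma>)
  show ?case
  proof (cases "i = hd s")
    case False
    with Cons.prems \<sigma> have "i \<in> set (fst (advance I a \<sigma>))"
      by (cases a; cases s) auto
    moreover have "wf_state (advance I a \<sigma>)" "accepted I (advance I a \<sigma>) u"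
      using Cons.prems wf_advance[OF assms(1)] by auto
    ultimately obtain j where "(i, j) \<in> arcs I (advance I a \<sigma>) u"
      using Cons.IH by blast
    then show ?thesis by auto
  next
    case True
    then have "(i, hd r) = arc \<sigma>" using \<sigma> by simp
    then show ?thesis using arcs_simps(2) by blast
  qed
qed

text \<open>Besides the current arc, each step discards from the ground set only arcs that cross a
  later arc. Hence maximality of the later arcs extends to the whole set.\<close>

lemma arcs_max_noncrossing:
  assumes "finite I" "wf_state \<sigma>" "accepted I \<sigma> u"
  shows "max_noncrossing (ground I \<sigma>) (arcs I \<sigma> u)"
  using assms(2-)
proof (induction u arbitrary: \<sigma>)
  case Nil
  then show ?case
    by (cases \<sigma>) (auto simp: max_noncrossing_def length_Suc_conv)
next
  case (Cons a u)
  let ?\<sigma> = "advance I a \<sigma>"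
  have en: "enabled a \<sigma>" and acc: "accepted I ?\<sigma> u" and wf: "wf_state ?\<sigma>"
    using Cons.prems wf_advance[OF assms(1)] by auto
  note IH = max_noncrossingD[OF Cons.IH[OF wf acc]]
  have sub: "arcs I \<sigma> (a # u) \<subseteq> ground I \<sigma>"
    using arcs_subset_ground[OF assms(1) Cons.prems(1), of "a # u"] Cons.prems(2)
    by (simp add: accepted_def)
  have nc: "\<not> cross p q" if "p \<in> arcs I \<sigma> (a # u)" "q \<in> arcs I \<sigma> (a # u)" for p q
  proof (cases "p = arc \<sigma> \<or> q = arc \<sigma>")
    case True
    then show ?thesis using arc_not_cross[OF Cons.prems(1)] sub that by blast
  next
    case False
    then show ?thesis using IH(2) that by simp
  qed
  have "p \<in> arcs I \<sigma> (a # u)"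
    if p: "p \<in> ground I \<sigma>"
      and np: "\<And>q. q \<in> arcs I \<sigma> (a # u) \<Longrightarrow> \<not> cross p q \<and> \<not> cross q p" for p
  proof (cases "p = arc \<sigma> \<or> p \<in> ground I ?\<sigma>")
    case True
    then show ?thesis
    proof
      assume "p \<in> ground I ?\<sigma>"
      then have "p \<in> arcs I ?\<sigma> u" by (rule IH(3)) (use np in simp)
      then show ?thesis by simp
    qed simp
  next
    case False
    obtain s r where \<sigma>: "\<sigma> = (s, r)" by (cases \<sigma>)
    obtain b c where pbc: "p = (b, c)" by (cases p)
    show ?thesis
    proof (cases a)
      case East
      with en \<sigma> obtain i i' s' where s: "s = i # i' # s'"
        by (cases s; cases "tl s") auto
      \<comment> \<open>A discarded arc other than the current one joins the popped vertex
        \<open>i\<close> to a later barred vertex, so it crosses the next arc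
        \<open>(i', hd r)\<close>.\<close>
      have "(i', hd r) \<in> arcs I \<sigma> (a # u)"
        using arc_in_arcs[of ?\<sigma> I u] \<sigma> East s by simp
      moreover have "cross (i', hd r) p"
        using False p Cons.prems(1) pbc \<sigma> East s by (cases r) auto
      ultimately show ?thesis using np by blast
    next
      case North
      with en \<sigma> obtain j j' r' where r: "r = j # j' # r'"
        by (cases r; cases "tl r") auto
      obtain i s' where s: "s = i # s'" using Cons.prems(1) \<sigma> by (cases s) auto
      \<comment> \<open>A discarded arc other than the current one joins a vertex below the top
        \<open>i\<close> to \<open>j\<close>. It crosses any later arc of \<open>i\<close>, and
        there is one because \<open>i\<close> stays on the stack.\<close>
      obtain d where d: "(i, d) \<in> arcs I ?\<sigma> u"
        using stack_vertex_has_arc[OF assms(1) wf acc, of i] \<sigma> North s by auto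
      then have "(i, d) \<in> ground I ?\<sigma>" using IH(1) by blast
      then have "j < d" using \<sigma> North r Cons.prems(1) by auto
      moreover have "b < i \<and> i \<le> j \<and> c = j"
        using False p Cons.prems(1) pbc \<sigma> North s r assms(1) by auto
      ultimately have "cross p (i, d)" using pbc by simp
      then show ?thesis using np[of "(i, d)"] d by auto
    qed
  qed
  then show ?case using sub nc unfolding max_noncrossing_def by blast
qed

text \<open>Arcs of the smaller ground set never cross the current arc, so dropping it from
  \<open>T\<close> makes no further arc compatible.\<close>

lemma max_noncrossing_remove_arc:
  assumes "finite I" "wf_state \<sigma>" "enabled a \<sigma>" "max_noncrossing (ground I \<sigma>) T"
    and "T - {arc \<sigma>} \<subseteq> ground I (advance I a \<sigma>)"
  shows "max_noncrossing (ground I (advance I a \<sigma>)) (T - {arc \<sigma>})"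
  using assms(4,5) ground_advance[OF assms(1-3)] arc_not_cross[OF assms(2)]
  unfolding max_noncrossing_def by blast

text \<open>The word is read off \<open>T\<close>: pop while another stack vertex has an arc to the
  current barred vertex, otherwise push. The induction is lexicographic because a north step
  shortens the list of barred vertices but may raise the stack.\<close>

lemma max_noncrossing_is_arcs:
  assumes "finite I" "wf_state \<sigma>" "set (fst \<sigma>) \<subseteq> I" "\<forall>i \<in> I. i \<le> last (snd \<sigma>)"
    and "max_noncrossing (ground I \<sigma>) T"
  shows "\<exists>u. accepted I \<sigma> u \<and> arcs I \<sigma> u = T"
  using assms(2-)
proof (induction "(length (snd \<sigma>), length (fst \<sigma>))" arbitrary: \<sigma> T
    rule: wf_induct_rule[OF wf_lex_prod[OF wf_less_than wf_less_than]])
  case (1 \<sigma> T)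
  obtain s r where \<sigma>: "\<sigma> = (s, r)" by (cases \<sigma>)
  obtain i s' where s: "s = i # s'" using 1(2) \<sigma> by (cases s) auto
  obtain j r' where r: "r = j # r'" using 1(2) \<sigma> by (cases r) auto
  note T = max_noncrossingD[OF 1(5)]
  \<comment> \<open>No available arc crosses the current one, so maximality forces it into
    \<open>T\<close>.\<close>
  have arcT: "arc \<sigma> \<in> T"
    using T(1) T(3)[OF arc_in_ground[OF 1(2)]] arc_not_cross[OF 1(2)] by blast
  have step: "\<exists>u. accepted I \<sigma> u \<and> arcs I \<sigma> u = T"
    if en: "enabled a \<sigma>" and sub: "T - {arc \<sigma>} \<subseteq> ground I (advance I a \<sigma>)" for a
  proof -
    have "((length (snd (advance I a \<sigma>)), length (fst (advance I a \<sigma>))),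
        (length (snd \<sigma>), length (fst \<sigma>))) \<in> less_than <*lex*> less_than"
      using en \<sigma> s r by (cases a) auto
    moreover have "set (fst (advance I a \<sigma>)) \<subseteq> I"
      using 1(3) \<sigma> s assms(1) by (cases a) auto
    moreover have "\<forall>i \<in> I. i \<le> last (snd (advance I a \<sigma>))"
      using 1(4) \<sigma> r en by (cases a; cases r') auto
    ultimately have "\<exists>u. accepted I (advance I a \<sigma>) u \<and> arcs I (advance I a \<sigma>) u = T - {arc \<sigma>}"
      by (rule 1(1)[OF _ wf_advance[OF assms(1) 1(2) en] _ _
            max_noncrossing_remove_arc[OF assms(1) 1(2) en 1(5) sub]])
    then obtain u where "accepted I (advance I a \<sigma>) u" "arcs I (advance I a \<sigma>) u = T - {arc \<sigma>}"
      by blast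
    then have "accepted I \<sigma> (a # u) \<and> arcs I \<sigma> (a # u) = T"
      using en by (simp add: insert_absorb[OF arcT])
    then show ?thesis by blast
  qed
  consider (pop) c where "c \<in> set s'" "(c, j) \<in> T" | (push) "\<forall>c \<in> set s'. (c, j) \<notin> T"
    by fast
  then show ?case
  proof cases
    case pop
    then have ci: "c < i" "i \<le> j" using 1(2) \<sigma> s r by auto
    \<comment> \<open>An arc of \<open>T\<close> from \<open>i\<close> to a later barred vertex
      would cross \<open>(c, j)\<close>, so popping \<open>i\<close> loses only the current
      arc.\<close>
    have "p \<in> ground I (tl s, r)" if "p \<in> T - {arc \<sigma>}" for p
    proof -
      obtain b d where p: "p = (b, d)" by (cases p)
      have "p \<in> ground I \<sigma>" using that T(1) by blast
      moreover have "\<not> cross (c, j) p" using T(2) pop(2) that by blast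
      ultimately show ?thesis using that ci 1(2) p \<sigma> s r by auto
    qed
    then show ?thesis using step[of East] pop \<sigma> s by (cases s') auto
  next
    case push
    show ?thesis
    proof (cases r')
      case Nil
      \<comment> \<open>Arcs with the same barred end never cross, so a second stack vertex would
        have its arc to \<open>j\<close> in \<open>T\<close>.\<close>
      have "s' = []"
      proof (cases s')
        case (Cons c s'')
        have "(c, j) \<in> T"
        proof (rule T(3))
          show "(c, j) \<in> ground I \<sigma>" using 1(2) \<sigma> s r Cons by auto
          show "\<not> cross (c, j) q \<and> \<not> cross q (c, j)" if "q \<in> T" for q
            using that T(1) \<sigma> r Nil by (cases q) auto
        qed
        then show ?thesis using push Cons by auto
      qed
      moreover have "T = {arc \<sigma>}"
        using arcT T(1) \<sigma> s r Nil calculation 1(2) by fastforce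
      ultimately show ?thesis
        using \<sigma> s r Nil by (intro exI[of _ "[]"]) auto
    next
      case (Cons j' r'')
      \<comment> \<open>The available arcs at \<open>j\<close> start on the stack, and by the case
        assumption only the one from the top lies in \<open>T\<close>.\<close>
      have "p \<in> ground I (advance I North \<sigma>)" if "p \<in> T - {arc \<sigma>}" for p
      proof -
        obtain b d where p: "p = (b, d)" by (cases p)
        have "p \<in> ground I \<sigma>" using that T(1) by blast
        then show ?thesis using that push 1(2) p \<sigma> s r Cons assms(1) by auto
      qed
      then show ?thesis using step[of North] \<sigma> r Cons by auto
    qed
  qed
qed

section \<open>Recovering a word from the degrees of its arcs\<close>

lemma join_North_Cons: "join_North ((x # w) # ws) = x # join_North (w # ws)"
  by (cases ws) auto

lemma join_North_Nil: "ws \<noteq> [] \<Longrightarrow> join_North ([] # ws) = North # join_North ws"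
  by (cases ws) auto

text \<open>The arcs at a barred vertex correspond to the lattice points of one row, one more than
  the east steps in it. An initial east step adds one arc to the first row; an initial north step
  leaves a single arc there, which gives an empty block.\<close>

lemma join_North_arcs:
  assumes "finite I" "wf_state \<sigma>" "accepted I \<sigma> u"
  shows "join_North (map (\<lambda>j. replicate (bar_degree (arcs I \<sigma> u) j - 1) East) (snd \<sigma>)) = u"
  using assms(2-)
proof (induction u arbitrary: \<sigma>)
  case Nil
  then show ?case by (cases \<sigma>) (auto simp: length_Suc_conv bar_degree_def)
next
  case (Cons a u)
  let ?\<sigma> = "advance I a \<sigma>"
  have en: "enabled a \<sigma>" and acc: "accepted I ?\<sigma> u" and wf: "wf_state ?\<sigma>"
    using Cons.prems wf_advance[OF assms(1)] by auto
  note IH = Cons.IH[OF wf acc]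
  have sub: "arcs I ?\<sigma> u \<subseteq> ground I ?\<sigma>"
    using arcs_subset_ground[OF assms(1) wf] acc by (simp add: accepted_def)
  obtain s r where \<sigma>: "\<sigma> = (s, r)" by (cases \<sigma>)
  obtain i s' where s: "s = i # s'" using Cons.prems(1) \<sigma> by (cases s) auto
  obtain j r' where r: "r = j # r'" using Cons.prems(1) \<sigma> by (cases r) auto
  have other: "bar_degree (arcs I \<sigma> (a # u)) x = bar_degree (arcs I ?\<sigma> u) x" if "x \<noteq> j" for x
    using that \<sigma> s r by (simp add: bar_degree_def)
  let ?f = "\<lambda>j. replicate (bar_degree (arcs I \<sigma> (a # u)) j - 1) East"
  let ?g = "\<lambda>j. replicate (bar_degree (arcs I ?\<sigma> u) j - 1) East"
  have rest: "map ?f r' = map ?g r'"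
    using other Cons.prems(1) \<sigma> r by auto
  show ?case
  proof (cases a)
    case East
    let ?D = "{c. (c, j) \<in> arcs I ?\<sigma> u}"
    have fin: "finite ?D"
    proof (rule finite_subset)
      show "?D \<subseteq> {..j}" using sub \<sigma> East by auto
    qed simp
    have "hd s' \<in> ?D" using arc_in_arcs[of ?\<sigma> I u] \<sigma> East s r by auto
    \<comment> \<open>Positivity makes the truncated subtraction in the exponent harmless.\<close>
    then have pos: "card ?D > 0" using fin by (auto simp: card_gt_0_iff)
    have "i \<notin> ?D" using sub \<sigma> East s r Cons.prems(1) by auto
    moreover have "{c. (c, j) \<in> arcs I \<sigma> (a # u)} = insert i ?D" using \<sigma> s r by auto
    ultimately have "bar_degree (arcs I \<sigma> (a # u)) j = Suc (bar_degree (arcs I ?\<sigma> u) j)"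
      using fin by (simp add: bar_degree_def)
    then have "replicate (bar_degree (arcs I \<sigma> (a # u)) j - 1) East
        = East # replicate (bar_degree (arcs I ?\<sigma> u) j - 1) East"
      using pos by (simp add: bar_degree_def flip: replicate_Suc)
    then have eq: "map ?f r = (East # ?g j) # map ?g r'"
      unfolding r list.map rest by (simp only:)
    have "snd \<sigma> = r" using \<sigma> by simp
    then have "join_North (map ?f (snd \<sigma>)) = East # join_North (?g j # map ?g r')"
      by (simp only: eq join_North_Cons)
    also have "?g j # map ?g r' = map ?g (snd ?\<sigma>)" using \<sigma> East r by simp
    finally show ?thesis using IH East by (simp only:)
  next
    case North
    have "{c. (c, j) \<in> arcs I \<sigma> (a # u)} = {i}"
      using sub \<sigma> North s r Cons.prems(1) en by (cases r') auto
    then have "bar_degree (arcs I \<sigma> (a # u)) j = 1" by (simp add: bar_degree_def)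
    then have eq: "map ?f r = [] # map ?g r'"
      unfolding r list.map rest by simp
    have "snd \<sigma> = r" "map ?g r' \<noteq> []" using \<sigma> r en North by auto
    then have "join_North (map ?f (snd \<sigma>)) = North # join_North (map ?g r')"
      by (simp only: eq join_North_Nil not_False_eq_True)
    also have "map ?g r' = map ?g (snd ?\<sigma>)" using \<sigma> North r by simp
    finally show ?thesis using IH North by (simp only:)
  qed
qed


section \<open>Parts of a run: later arcs, stack heights, independence of the stack bottom\<close>

lemma arc_take_in_ground:
  assumes "finite I" "wf_state \<sigma>" "admissible I \<sigma> u" "k \<le> m" "m \<le> length u"
  shows "arc (run I \<sigma> (take m u)) \<in> ground I (run I \<sigma> (take k u))"
proof -
  have "take k (take m u) @ drop k (take m u) = take m u" by (rule append_take_drop_id)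
  then have m: "take m u = take k u @ drop k (take m u)" using assms(4) by (simp add: min_def)
  moreover have "admissible I \<sigma> (take m u)"
    using assms(3) append_take_drop_id[of m u] admissible_append by metis
  ultimately have "admissible I \<sigma> (take k u)"
    and "admissible I (run I \<sigma> (take k u)) (drop k (take m u))"
    using admissible_append by metis+
  then have "arcs I (run I \<sigma> (take k u)) (drop k (take m u)) \<subseteq> ground I (run I \<sigma> (take k u))"
    using arcs_subset_ground[OF assms(1)] wf_run[OF assms(1,2)] by blast
  moreover have "arc (run I \<sigma> (take m u)) \<in> arcs I (run I \<sigma> (take k u)) (drop k (take m u))"
    by (subst m) (simp add: arcs_def)
  ultimately show ?thesis by blast
qed

text \<open>A discrete intermediate value argument: a step may raise the stack by any amount but
  lowers it by at most one.\<close>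

lemma stack_height_reached:
  assumes "n \<le> length (fst \<sigma>)" "length (fst (run I \<sigma> v)) \<le> n"
  shows "\<exists>m \<le> length v. length (fst (run I \<sigma> (take m v))) = n"
  using assms
proof (induction v arbitrary: \<sigma>)
  case (Cons a v)
  show ?case
  proof (cases "length (fst \<sigma>) = n")
    case False
    then have "n \<le> length (fst (advance I a \<sigma>))" using Cons.prems(1) by (cases a; cases \<sigma>) auto
    then obtain m where "m \<le> length v" "length (fst (run I (advance I a \<sigma>) (take m v))) = n"
      using Cons.IH[of "advance I a \<sigma>"] Cons.prems(2) by (simp only: run.simps) blast
    then show ?thesis by (intro exI[of _ "Suc m"]) simp
  qed (auto intro: exI[of _ 0])
qed simp

text \<open>
  As long as the stack stays strictly higher than its bottom part \<open>b\<close>, a run does not depend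
  on \<open>b\<close>.
\<close>

lemma run_replace_bottom:
  assumes "\<And>k. k < length v \<Longrightarrow> length (fst (run I (t @ b, r) (take k v))) \<noteq> length b"
    and "length (fst (run I (t @ b, r) v)) = length b" and "b \<noteq> []" "b' \<noteq> []"
  shows "\<exists>r'. run I (t @ b, r) v = (b, r') \<and> run I (t @ b', r) v = (b', r') \<and>
    trail I (t @ b', r) v = trail I (t @ b, r) v \<and>
    (admissible I (t @ b', r) v \<longleftrightarrow> admissible I (t @ b, r) v)"
  using assms(1,2)
proof (induction v arbitrary: t r)
  case Nil
  then show ?case by auto
next
  case (Cons a v)
  have "t \<noteq> []" using Cons.prems(1)[of 0] by auto
  then obtain i t' where t: "t = i # t'" by (cases t) auto
  define t'' where "t'' = fst (advance I a (t, r))"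
  define r'' where "r'' = snd (advance I a (t, r))"
  have adv: "advance I a (t @ c, r) = (t'' @ c, r'')" for c
    using t by (cases a) (auto simp: t''_def r''_def)
  have "\<exists>r'. run I (t'' @ b, r'') v = (b, r') \<and> run I (t'' @ b', r'') v = (b', r') \<and>
    trail I (t'' @ b', r'') v = trail I (t'' @ b, r'') v \<and>
    (admissible I (t'' @ b', r'') v \<longleftrightarrow> admissible I (t'' @ b, r'') v)"
  proof (rule Cons.IH)
    show "length (fst (run I (t'' @ b, r'') (take k v))) \<noteq> length b" if "k < length v" for k
      using Cons.prems(1)[of "Suc k"] that by (simp add: adv)
    show "length (fst (run I (t'' @ b, r'') v)) = length b"
      using Cons.prems(2) by (simp add: adv)
  qed
  moreover have "enabled a (t @ b, r) \<longleftrightarrow> enabled a (t @ b', r)"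
    using assms(3,4) t by (cases a; cases b; cases b') auto
  moreover have "arc (t @ b, r) = arc (t @ b', r)" using t by simp
  ultimately show ?case by (auto simp: adv)
qed

text \<open>The first lattice point has the bottom itself as its stack, so its arc depends on the
  bottom; the arcs of the later points before the end, collected in \<open>X\<close>, do
  not.\<close>

lemma run_North_replace_bottom:
  assumes "\<And>k. k < length v \<Longrightarrow> length (fst (run I (b, r) (take (Suc k) (North # v)))) \<noteq> length b"
    and "length (fst (run I (b, r) (North # v))) = length b" and "b \<noteq> []" "b' \<noteq> []"
  shows "\<exists>r' X. run I (b, r) (North # v) = (b, r') \<and> run I (b', r) (North # v) = (b', r') \<and>
    trail I (b, r) (North # v) = insert (arc (b, r)) X \<and>
    trail I (b', r) (North # v) = insert (arc (b', r)) X \<and>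
    (admissible I (b', r) (North # v) \<longleftrightarrow> admissible I (b, r) (North # v))"
  using run_replace_bottom[of v I "rev (sorted_list_of_set {i \<in> I. hd r < i \<and> i \<le> hd (tl r)})" b "tl r" b']
    assms by auto


section \<open>Sorted lists and the path \<open>\<nu>\<close>\<close>

lemma card_le_nth_sorted_list_of_set:
  fixes A :: "'a::linorder set"
  assumes "finite A" "k < card A"
  shows "card {a \<in> A. a \<le> sorted_list_of_set A ! k} = Suc k"
    and "set (take (Suc k) (sorted_list_of_set A)) = {a \<in> A. a \<le> sorted_list_of_set A ! k}"
proof -
  let ?l = "sorted_list_of_set A"
  have len: "k < length ?l" using assms by simp
  show eq: "set (take (Suc k) ?l) = {a \<in> A. a \<le> ?l ! k}"
  proof
    show "set (take (Suc k) ?l) \<subseteq> {a \<in> A. a \<le> ?l ! k}"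
    proof
      fix a assume "a \<in> set (take (Suc k) ?l)"
      then obtain m where "m < Suc k" "a = ?l ! m" by (auto simp: in_set_conv_nth)
      then show "a \<in> {a \<in> A. a \<le> ?l ! k}"
        using len assms sorted_nth_mono[of ?l m k] nth_mem[of m ?l] by auto
    qed
    show "{a \<in> A. a \<le> ?l ! k} \<subseteq> set (take (Suc k) ?l)"
    proof
      fix a assume a: "a \<in> {a \<in> A. a \<le> ?l ! k}"
      then have "a \<in> set ?l" using assms by simp
      then obtain m where m: "m < length ?l" "a = ?l ! m" by (auto simp: in_set_conv_nth)
      have "m \<le> k"
      proof (rule ccontr)
        assume "\<not> m \<le> k"
        then have "?l ! k < ?l ! m"
          using m(1) strict_sorted_list_of_set[of A] by (auto simp: sorted_wrt_iff_nth_less)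
        then show False using a m leD by blast
      qed
      then show "a \<in> set (take (Suc k) ?l)"
        using m by (auto simp: in_set_conv_nth intro!: exI[of _ m])
    qed
  qed
  have "card (set (take (Suc k) ?l)) = Suc k"
    using len by (subst distinct_card) auto
  then show "card {a \<in> A. a \<le> ?l ! k} = Suc k" using eq by simp
qed

lemma vertex_le_iff [simp]:
  "Plain i \<le> Plain i' \<longleftrightarrow> i \<le> i'"
  "Plain i \<le> Bar j \<longleftrightarrow> i \<le> j"
  "Bar j \<le> Plain i \<longleftrightarrow> j < i"
  "Bar j \<le> Bar j' \<longleftrightarrow> j \<le> j'"
  unfolding less_eq_vertex_def by (simp_all, presburger+)

lemma count_vertex_step:
  "distinct vs \<Longrightarrow> count_list (map vertex_step vs) East = card {i. Plain i \<in> set vs}"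
  "distinct vs \<Longrightarrow> count_list (map vertex_step vs) North = card {j. Bar j \<in> set vs}"
proof (induction vs)
  case (Cons v vs)
  have fin: "finite {i. Plain i \<in> set vs}" "finite {j. Bar j \<in> set vs}"
    using finite_vimageI[of "set vs" Plain] finite_vimageI[of "set vs" Bar]
    by (auto simp: inj_on_def vimage_def)
  {
    case 1
    have "{i. Plain i \<in> set (v # vs)} =
        (case v of Plain i \<Rightarrow> insert i {i. Plain i \<in> set vs} | Bar j \<Rightarrow> {i. Plain i \<in> set vs})"
      by (auto split: vertex.split)
    then show ?case using 1 Cons fin by (cases v) auto
  next
    case 2
    have "{j. Bar j \<in> set (v # vs)} =
        (case v of Bar j \<Rightarrow> insert j {j. Bar j \<in> set vs} | Plain i \<Rightarrow> {j. Bar j \<in> set vs})"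
      by (auto split: vertex.split)
    then show ?case using 2 Cons fin by (cases v) auto
  }
qed auto

text \<open>The state of the origin: the first barred vertex is current, and the plain vertices
  before it are stacked with the least one at the bottom.\<close>

definition start :: "nat set \<Rightarrow> nat set \<Rightarrow> state" where
  "start I J = (rev (sorted_list_of_set {i \<in> I. i \<le> Min J}), sorted_list_of_set J)"

text \<open>For \<open>y < card J\<close>, the number of lattice points at height \<open>y\<close>
  that are not strictly below \<nu>; see \<open>strictly_below_nu_iff\<close>.\<close>

definition row_width :: "nat set \<Rightarrow> nat set \<Rightarrow> nat \<Rightarrow> nat" where
  "row_width I J y = card {i \<in> I. i \<le> sorted_list_of_set J ! y}"

locale alternating_pair =
  fixes I J :: "nat set"
  assumes finite_I: "finite I" and finite_J: "finite J" and J_nonempty: "J \<noteq> {}"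
    and min_plain: "Min (vertices I J) \<in> Plain ` I"
    and max_bar: "Max (vertices I J) \<in> Bar ` J"
begin

lemma finite_vertices: "finite (vertices I J)"
  using finite_I finite_J by (simp add: vertices_def)

lemma in_vertices [simp]: "Plain i \<in> vertices I J \<longleftrightarrow> i \<in> I" "Bar j \<in> vertices I J \<longleftrightarrow> j \<in> J"
  by (auto simp: vertices_def)

lemma I_le_Max_J: "i \<in> I \<Longrightarrow> i \<le> Max J"
proof -
  assume "i \<in> I"
  moreover obtain j where j: "j \<in> J" "Max (vertices I J) = Bar j" using max_bar by auto
  ultimately have "Plain i \<le> Bar j" using finite_vertices Max_ge by (metis in_vertices(1))
  then show ?thesis using Max_ge[OF finite_J j(1)] by simp
qed

lemma least_plain: "\<exists>i \<in> I. \<forall>j \<in> J. i \<le> j"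
proof -
  obtain i where i: "i \<in> I" "Min (vertices I J) = Plain i" using min_plain by auto
  then have "Plain i \<le> Bar j" if "j \<in> J" for j
    using finite_vertices Min_le that by (metis in_vertices(2))
  with i show ?thesis by auto
qed

lemma card_J_pos: "0 < card J"
  using finite_J J_nonempty by (simp add: card_gt_0_iff)

lemma sorted_J_nth:
  assumes "y < card J"
  shows "sorted_list_of_set J ! y \<in> J"
  using assms finite_J nth_mem[of y "sorted_list_of_set J"] by simp

lemma row_width_pos: "y < card J \<Longrightarrow> 0 < row_width I J y"
  using least_plain sorted_J_nth finite_I by (auto simp: row_width_def card_gt_0_iff)

lemma hd_sorted_J: "hd (sorted_list_of_set J) = Min J"
  using finite_J J_nonempty by (subst sorted_list_of_set_nonempty) auto

lemma last_sorted_J: "sorted_list_of_set J ! (card J - 1) = Max J"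
proof -
  let ?j = "sorted_list_of_set J ! (card J - 1)"
  have "card {j \<in> J. j \<le> ?j} = card J"
    using card_le_nth_sorted_list_of_set(1)[OF finite_J, of "card J - 1"] card_J_pos by simp
  then have "{j \<in> J. j \<le> ?j} = J"
    by (intro card_subset_eq[OF finite_J]) auto
  then have "Max J \<le> ?j" using Max_in[OF finite_J J_nonempty] by blast
  moreover have "?j \<le> Max J" using sorted_J_nth[of "card J - 1"] card_J_pos finite_J by simp
  ultimately show ?thesis by simp
qed

lemma row_width_last: "row_width I J (card J - 1) = card I"
proof -
  have "{i \<in> I. i \<le> Max J} = I" using I_le_Max_J by auto
  then show ?thesis unfolding row_width_def last_sorted_J by simp
qed

lemma nu_path_split:
  obtains i j vs where "sorted_list_of_set (vertices I J) = Plain i # vs @ [Bar j]"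
    and "nu_path I J = map vertex_step vs"
proof -
  let ?V = "vertices I J" let ?l = "sorted_list_of_set ?V"
  obtain j0 where "j0 \<in> J" using J_nonempty by blast
  then have ne: "?V \<noteq> {}" by (auto simp: vertices_def)
  then have hd: "hd ?l = Min ?V" using finite_vertices by (subst sorted_list_of_set_nonempty) auto
  have "last ?l = Max ?V"
  proof (rule Max_eqI[symmetric])
    have nel: "?l \<noteq> []" using ne finite_vertices by simp
    then show "last ?l \<in> ?V" using last_in_set[of ?l] finite_vertices by simp
    fix v assume "v \<in> ?V"
    then have "v \<in> set ?l" using finite_vertices by simp
    then obtain m where m: "m < length ?l" "v = ?l ! m" unfolding in_set_conv_nth by blast
    have "?l ! m \<le> ?l ! (length ?l - 1)" using m(1) by (intro sorted_nth_mono) auto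
    then show "v \<le> last ?l" unfolding m(2) last_conv_nth[OF nel] .
  qed (rule finite_vertices)
  moreover obtain i where i: "hd ?l = Plain i" using hd min_plain by auto
  ultimately obtain j where j: "last ?l = Bar j" using max_bar by auto
  obtain a vs' where l: "?l = a # vs'" using ne finite_vertices by (cases ?l) auto
  then obtain vs b where "vs' = vs @ [b]" using i j by (cases vs' rule: rev_cases) auto
  with l i j have l: "?l = Plain i # vs @ [Bar j]" by simp
  show ?thesis by (rule that[OF l]) (simp add: nu_path_def l)
qed

section \<open>The lattice points of \<nu> and the region weakly above it\<close>

lemma endpoint_nu: "endpoint (nu_path I J) = (card I - 1, card J - 1)"
proof -
  obtain i j vs where l: "sorted_list_of_set (vertices I J) = Plain i # vs @ [Bar j]"
    and nu: "nu_path I J = map vertex_step vs" by (rule nu_path_split)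
  have d: "distinct (Plain i # vs @ [Bar j])" and s: "set (Plain i # vs @ [Bar j]) = vertices I J"
    unfolding l[symmetric] using finite_vertices by auto
  have "Suc (count_list (map vertex_step vs) East) = card I"
    using count_vertex_step(1)[OF d] unfolding s by simp
  moreover have "Suc (count_list (map vertex_step vs) North) = card J"
    using count_vertex_step(2)[OF d] unfolding s by simp
  ultimately show ?thesis unfolding endpoint_def path_point_def nu by auto
qed

text \<open>After \<open>k\<close> steps the first \<open>k + 1\<close> vertices have been passed,
  so the lattice points are indexed by the vertices other than the greatest. The subtraction of one
  accounts for the least vertex, a plain one without a step.\<close>

lemma path_points_nu:
  "path_points (nu_path I J) =
     (\<lambda>v. (card {i \<in> I. Plain i \<le> v} - 1, card {j \<in> J. Bar j \<le> v})) `
       (vertices I J - {Max (vertices I J)})"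
proof -
  let ?V = "vertices I J"
  obtain a j vs where l: "sorted_list_of_set ?V = Plain a # vs @ [Bar j]"
    and nu: "nu_path I J = map vertex_step vs" by (rule nu_path_split)
  have d: "distinct (Plain a # vs @ [Bar j])" and s: "set (Plain a # vs @ [Bar j]) = ?V"
    and srt: "sorted (Plain a # vs @ [Bar j])"
    unfolding l[symmetric] using finite_vertices by auto
  have "Max ?V = Bar j"
  proof (rule Max_eqI)
    show "v \<le> Bar j" if "v \<in> ?V" for v
      using that srt unfolding s[symmetric] by (auto simp: sorted_append)
    show "Bar j \<in> ?V" unfolding s[symmetric] by simp
  qed (rule finite_vertices)
  then have "?V - {Max ?V} = set (Plain a # vs)"
    using s d by auto
  also have "\<dots> = (!) (Plain a # vs) ` {..<length (Plain a # vs)}"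
    unfolding set_conv_nth by blast
  finally have nodes: "?V - {Max ?V} = (!) (Plain a # vs) ` {..length vs}"
    by (simp only: list.size(4) add_0_right add_Suc_right lessThan_Suc_atMost)
  have point: "path_point (nu_path I J) k =
      (card {i \<in> I. Plain i \<le> (Plain a # vs) ! k} - 1, card {j \<in> J. Bar j \<le> (Plain a # vs) ! k})"
    if k: "k \<le> length vs" for k
  proof -
    let ?v = "(Plain a # vs) ! k"
    have v: "sorted_list_of_set ?V ! k = ?v" using k unfolding l by (cases k) (auto simp: nth_append)
    have "k < card ?V" using k length_sorted_list_of_set[of ?V] l by simp
    from card_le_nth_sorted_list_of_set(2)[OF finite_vertices this]
    have set: "set (Plain a # take k vs) = {u \<in> ?V. u \<le> ?v}"
      unfolding v unfolding l using k by simp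
    have d': "distinct (Plain a # take k vs)" using d by (auto dest: in_set_takeD)
    have E: "Suc (count_list (map vertex_step (take k vs)) East) = card {i \<in> I. Plain i \<le> ?v}"
      using count_vertex_step(1)[OF d'] unfolding set by simp
    have N: "count_list (map vertex_step (take k vs)) North = card {j \<in> J. Bar j \<le> ?v}"
      using count_vertex_step(2)[OF d'] unfolding set by simp
    show ?thesis unfolding path_point_def nu take_map E[symmetric] N by simp
  qed
  have "path_points (nu_path I J) = path_point (nu_path I J) ` {..length vs}"
    by (auto simp: path_points_def nu)
  then show ?thesis unfolding nodes image_image by (simp only:) (rule image_cong[OF refl point], simp)
qed

text \<open>The point is allowed when \<nu> reaches abscissa \<open>x\<close> at height at most
  \<open>y\<close>. This happens iff the plain vertex with index \<open>x\<close> in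
  \<open>I\<close> precedes the barred vertex with index \<open>y\<close> in \<open>J\<close>,
  counting from 0.\<close>

lemma strictly_below_nu_iff:
  assumes "y < card J"
  shows "strictly_below (nu_path I J) (x, y) \<longleftrightarrow> row_width I J y \<le> x"
proof -
  let ?V = "vertices I J" let ?j = "sorted_list_of_set J ! y"
  have "strictly_below (nu_path I J) (x, y) \<longleftrightarrow>
      \<not> (\<exists>v \<in> ?V - {Max ?V}. card {i \<in> I. Plain i \<le> v} - 1 = x \<and> card {j \<in> J. Bar j \<le> v} \<le> y)"
    by (simp add: strictly_below_def path_points_nu not_le)
  moreover have "(\<exists>v \<in> ?V - {Max ?V}. card {i \<in> I. Plain i \<le> v} - 1 = x \<and> card {j \<in> J. Bar j \<le> v} \<le> y)
      \<longleftrightarrow> x < row_width I J y"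
  proof
    assume "\<exists>v \<in> ?V - {Max ?V}. card {i \<in> I. Plain i \<le> v} - 1 = x \<and> card {j \<in> J. Bar j \<le> v} \<le> y"
    then obtain v where v: "v \<in> ?V" "card {i \<in> I. Plain i \<le> v} - 1 = x" "card {j \<in> J. Bar j \<le> v} \<le> y"
      by blast
    \<comment> \<open>At most \<open>y\<close> barred vertices come up to \<open>v\<close>, whereas
      \<open>y + 1\<close> come up to \<open>Bar ?j\<close>.\<close>
    have "\<not> Bar ?j \<le> v"
    proof
      assume "Bar ?j \<le> v"
      then have "Bar j \<le> v" if "j \<le> ?j" for j using that order.trans[of "Bar j" "Bar ?j"] by simp
      then have "card {j \<in> J. j \<le> ?j} \<le> card {j \<in> J. Bar j \<le> v}"
        using finite_J by (intro card_mono) auto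
      then show False using v card_le_nth_sorted_list_of_set(1)[OF finite_J assms] by simp
    qed
    then have "Plain i \<le> v \<Longrightarrow> i \<le> ?j" for i
      using order.trans[of "Plain i" v "Bar ?j"] by simp
    then have "card {i \<in> I. Plain i \<le> v} \<le> row_width I J y"
      unfolding row_width_def using finite_I by (intro card_mono) auto
    moreover have "{i \<in> I. Plain i \<le> v} \<noteq> {}"
      using min_plain Min_le[OF finite_vertices v(1)] by auto
    then have "0 < card {i \<in> I. Plain i \<le> v}" using finite_I by (simp add: card_gt_0_iff)
    ultimately show "x < row_width I J y" using v(2) by simp
  next
    assume x: "x < row_width I J y"
    \<comment> \<open>The vertex with index \<open>x\<close> in \<open>I\<close> is the witness:
      \<nu> reaches abscissa \<open>x\<close> there.\<close>
    let ?i = "sorted_list_of_set I ! x"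
    have xI: "x < card I"
      using x card_mono[OF finite_I, of "{i \<in> I. i \<le> ?j}"] by (auto simp: row_width_def)
    then have iI: "?i \<in> I" using finite_I nth_mem[of x "sorted_list_of_set I"] by simp
    have ci: "card {i \<in> I. i \<le> ?i} = Suc x"
      using card_le_nth_sorted_list_of_set(1)[OF finite_I xI] .
    have "?i \<le> ?j"
    proof (rule ccontr)
      assume "\<not> ?i \<le> ?j"
      then have "{i \<in> I. i \<le> ?j} \<subseteq> {i \<in> I. i \<le> ?i}" "?i \<notin> {i \<in> I. i \<le> ?j}" by auto
      moreover have "?i \<in> {i \<in> I. i \<le> ?i}" using iI by simp
      ultimately have "{i \<in> I. i \<le> ?j} \<subset> {i \<in> I. i \<le> ?i}" by blast
      then have "card {i \<in> I. i \<le> ?j} < card {i \<in> I. i \<le> ?i}"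
        using finite_I by (intro psubset_card_mono) simp_all
      then have "row_width I J y < Suc x" unfolding row_width_def ci .
      then show False using x by simp
    qed
    then have "{j \<in> J. Bar j \<le> Plain ?i} \<subseteq> {j \<in> J. j \<le> ?j}" "?j \<notin> {j \<in> J. Bar j \<le> Plain ?i}"
      by auto
    moreover have "?j \<in> {j \<in> J. j \<le> ?j}" using sorted_J_nth[OF assms] by simp
    ultimately have "{j \<in> J. Bar j \<le> Plain ?i} \<subset> {j \<in> J. j \<le> ?j}" by blast
    then have "card {j \<in> J. Bar j \<le> Plain ?i} < card {j \<in> J. j \<le> ?j}"
      using finite_J by (intro psubset_card_mono) simp_all
    then have "card {j \<in> J. Bar j \<le> Plain ?i} \<le> y"
      unfolding card_le_nth_sorted_list_of_set(1)[OF finite_J assms] by simp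
    moreover have "card {i \<in> I. Plain i \<le> Plain ?i} - 1 = x" using ci by simp
    moreover have "Plain ?i \<in> ?V - {Max ?V}" using max_bar iI by auto
    ultimately show "\<exists>v \<in> ?V - {Max ?V}. card {i \<in> I. Plain i \<le> v} - 1 = x \<and>
        card {j \<in> J. Bar j \<le> v} \<le> y"
      by blast
  qed
  ultimately show ?thesis by (simp only: not_less)
qed

lemma horiz_nu:
  assumes "y < card J" "x < row_width I J y"
  shows "horiz (nu_path I J) (x, y) = row_width I J y - 1 - x"
proof -
  have "{h. \<forall>h' \<le> h. \<not> strictly_below (nu_path I J) (x + h', y)} = {..row_width I J y - 1 - x}"
    using assms by (auto simp: strictly_below_nu_iff[OF assms(1)] not_le)
  then show ?thesis by (auto simp: horiz_def intro: Max_eqI)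
qed


section \<open>Trees and Dyck paths\<close>

lemma wf_start: "wf_state (start I J)"
proof -
  have "{i \<in> I. i \<le> Min J} \<noteq> {}"
    using least_plain finite_J J_nonempty by auto
  then show ?thesis
    using finite_I finite_J J_nonempty hd_sorted_J by (auto simp: start_def sorted_wrt_rev)
qed

lemma ground_start: "ground I (start I J) = {(i, j). i \<in> I \<and> j \<in> J \<and> i \<le> j}"
  using finite_I finite_J hd_sorted_J by (auto simp: start_def)

lemma IJ_tree_iff_arcs:
  "IJ_tree I J T \<longleftrightarrow> (\<exists>\<mu>. accepted I (start I J) \<mu> \<and> arcs I (start I J) \<mu> = T)"
proof
  assume "IJ_tree I J T"
  moreover have "last (sorted_list_of_set J) = Max J"
    using last_sorted_J finite_J J_nonempty by (simp add: last_conv_nth)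
  then have "\<forall>i \<in> I. i \<le> last (snd (start I J))"
    using I_le_Max_J by (simp add: start_def)
  moreover have "set (fst (start I J)) \<subseteq> I" using finite_I by (auto simp: start_def)
  ultimately show "\<exists>\<mu>. accepted I (start I J) \<mu> \<and> arcs I (start I J) \<mu> = T"
    using max_noncrossing_is_arcs[OF finite_I wf_start] by (simp add: IJ_tree_iff ground_start)
next
  assume "\<exists>\<mu>. accepted I (start I J) \<mu> \<and> arcs I (start I J) \<mu> = T"
  then show "IJ_tree I J T"
    using arcs_max_noncrossing[OF finite_I wf_start] by (auto simp: IJ_tree_iff ground_start)
qed

lemma rho_arcs: "accepted I (start I J) \<mu> \<Longrightarrow> rho J (arcs I (start I J) \<mu>) = \<mu>"
  using join_North_arcs[OF finite_I wf_start] by (simp add: rho_def start_def)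

section \<open>Dyck paths as accepted words\<close>

lemma row_width_Suc:
  assumes "Suc y < card J"
  shows "row_width I J (Suc y) = row_width I J y +
    card {i \<in> I. sorted_list_of_set J ! y < i \<and> i \<le> sorted_list_of_set J ! Suc y}"
proof -
  let ?l = "sorted_list_of_set J"
  have "?l ! y \<le> ?l ! Suc y" using assms by (intro sorted_nth_mono) auto
  then have "{i \<in> I. i \<le> ?l ! Suc y} = {i \<in> I. i \<le> ?l ! y} \<union> {i \<in> I. ?l ! y < i \<and> i \<le> ?l ! Suc y}"
    by auto
  then show ?thesis
    unfolding row_width_def using finite_I by (subst card_Un_disjoint[symmetric]) auto
qed

lemma snd_run_start: "snd (run I (start I J) u) = drop (count_list u North) (sorted_list_of_set J)"
  by (simp add: snd_run start_def)

text \<open>Every plain vertex met so far is either on the stack or was removed by an east step.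
  Their number is the width of the current row.\<close>

lemma run_start:
  assumes "admissible I (start I J) u"
  shows "count_list u North < card J \<and>
    length (fst (run I (start I J) u)) + count_list u East = row_width I J (count_list u North)"
  using assms
proof (induction u rule: rev_induct)
  case Nil
  have "sorted_list_of_set J ! 0 = Min J"
    using hd_sorted_J finite_J J_nonempty by (simp add: hd_conv_nth)
  then show ?case using card_J_pos by (simp add: start_def row_width_def)
next
  case (snoc a u)
  let ?y = "count_list u North" let ?l = "sorted_list_of_set J"
  have IH: "?y < card J"
    "length (fst (run I (start I J) u)) + count_list u East = row_width I J ?y"
    and en: "enabled a (run I (start I J) u)"
    using snoc by auto
  obtain s where \<sigma>: "run I (start I J) u = (s, drop ?y ?l)"
    using snd_run_start by (metis prod.collapse)
  show ?case
  proof (cases a)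
    case East
    then show ?thesis using IH en \<sigma> by auto
  next
    case North
    then have y: "Suc ?y < card J" using en \<sigma> by auto
    then have "hd (drop ?y ?l) = ?l ! ?y" "hd (tl (drop ?y ?l)) = ?l ! Suc ?y"
      by (simp_all add: hd_drop_conv_nth tl_drop flip: drop_Suc)
    then show ?thesis using IH y \<sigma> North row_width_Suc[OF y] finite_I by simp
  qed
qed

text \<open>By \<open>run_start\<close> the stack height is the row width minus the abscissa, so the
  stack stays nonempty exactly when each lattice point has abscissa below the width of its
  row.\<close>

lemma admissible_start_iff:
  "admissible I (start I J) u \<longleftrightarrow>
     (\<forall>k \<le> length u. count_list (take k u) North < card J \<and>
        count_list (take k u) East < row_width I J (count_list (take k u) North))"
proof (induction u rule: rev_induct)
  case Nil
  then show ?case using card_J_pos row_width_pos by simp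
next
  case (snoc a u)
  let ?P = "\<lambda>v. count_list v North < card J \<and> count_list v East < row_width I J (count_list v North)"
  have "(\<forall>k \<le> length (u @ [a]). ?P (take k (u @ [a]))) \<longleftrightarrow> (\<forall>k \<le> length u. ?P (take k u)) \<and> ?P (u @ [a])"
  proof -
    have "(\<forall>k \<le> Suc n. Q k) \<longleftrightarrow> (\<forall>k \<le> n. Q k) \<and> Q (Suc n)" for Q :: "nat \<Rightarrow> bool" and n
      by (auto simp: le_Suc_eq)
    then show ?thesis by simp
  qed
  moreover have "enabled a (run I (start I J) u) \<longleftrightarrow> ?P (u @ [a])" if adm: "admissible I (start I J) u"
  proof -
    note u = run_start[OF adm]
    obtain s where \<sigma>: "run I (start I J) u = (s, drop (count_list u North) (sorted_list_of_set J))"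
      using snd_run_start by (metis prod.collapse)
    have "s \<noteq> []" using wf_run[OF finite_I wf_start adm] \<sigma> by simp
    then obtain i s' where "s = i # s'" by (cases s) auto
    then show ?thesis using u \<sigma> row_width_Suc[of "count_list u North"] by (cases a) auto
  qed
  moreover have "admissible I (start I J) (u @ [a]) \<longleftrightarrow>
      admissible I (start I J) u \<and> enabled a (run I (start I J) u)" by simp
  ultimately show ?case using snoc by blast
qed

text \<open>The last row has width \<open>card I\<close>, so a stack of height one there means
  abscissa \<open>card I - 1\<close>.\<close>

lemma final_run_start_iff:
  assumes "admissible I (start I J) u"
  shows "final (run I (start I J) u) \<longleftrightarrow>
    count_list u East = card I - 1 \<and> count_list u North = card J - 1"
proof -
  note u = run_start[OF assms]
  obtain s where \<sigma>: "run I (start I J) u = (s, drop (count_list u North) (sorted_list_of_set J))"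
    using snd_run_start by (metis prod.collapse)
  have "s \<noteq> []" using wf_run[OF finite_I wf_start assms] \<sigma> by simp
  then obtain n where "length s = Suc n" by (cases "length s") auto
  moreover have "card J - count_list u North = 1 \<longleftrightarrow> count_list u North = card J - 1"
    using u by auto
  ultimately show ?thesis using u \<sigma> row_width_last by auto
qed

lemma Dyck_path_iff: "Dyck_path (nu_path I J) \<mu> \<longleftrightarrow> accepted I (start I J) \<mu>"
proof
  assume \<mu>: "Dyck_path (nu_path I J) \<mu>"
  then have e: "count_list \<mu> East = card I - 1" "count_list \<mu> North = card J - 1"
    unfolding Dyck_path_def endpoint_nu by (auto simp: endpoint_def path_point_def)
  have "count_list (take k \<mu>) North < card J \<and>
        count_list (take k \<mu>) East < row_width I J (count_list (take k \<mu>) North)"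
    if "k \<le> length \<mu>" for k
  proof
    have "count_list (take k \<mu>) North \<le> count_list \<mu> North"
      using count_list_append[of "take k \<mu>" "drop k \<mu>" North] by simp
    then show y: "count_list (take k \<mu>) North < card J" using e card_J_pos by simp
    have "\<not> strictly_below (nu_path I J) (path_point \<mu> k)"
      using \<mu> that unfolding Dyck_path_def path_points_def by blast
    then show "count_list (take k \<mu>) East < row_width I J (count_list (take k \<mu>) North)"
      using strictly_below_nu_iff[OF y] by (simp add: path_point_def)
  qed
  then have "admissible I (start I J) \<mu>" using admissible_start_iff by blast
  then show "accepted I (start I J) \<mu>" using e final_run_start_iff by (simp add: accepted_def)
next
  assume "accepted I (start I J) \<mu>"
  then have adm: "admissible I (start I J) \<mu>"
    and "count_list \<mu> East = card I - 1 \<and> count_list \<mu> North = card J - 1"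
    using final_run_start_iff by (auto simp: accepted_def)
  then have "endpoint \<mu> = endpoint (nu_path I J)"
    unfolding endpoint_nu by (simp add: endpoint_def path_point_def)
  moreover have "\<not> strictly_below (nu_path I J) (path_point \<mu> k)" if "k \<le> length \<mu>" for k
    using adm that strictly_below_nu_iff unfolding admissible_start_iff
    by (auto simp: path_point_def not_le)
  ultimately show "Dyck_path (nu_path I J) \<mu>" by (auto simp: Dyck_path_def path_points_def)
qed

section \<open>States and stack heights at the lattice points of a path\<close>

abbreviation state_at :: "path \<Rightarrow> nat \<Rightarrow> state" where
  "state_at \<mu> k \<equiv> run I (start I J) (take k \<mu>)"

lemma admissible_take: "admissible I (start I J) \<mu> \<Longrightarrow> admissible I (start I J) (take k \<mu>)"
  using admissible_append append_take_drop_id by metis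

lemma wf_state_at: "admissible I (start I J) \<mu> \<Longrightarrow> wf_state (state_at \<mu> k)"
  using wf_run[OF finite_I wf_start] admissible_take by blast

lemma horiz_state_at:
  assumes "accepted I (start I J) \<mu>"
  shows "horiz (nu_path I J) (path_point \<mu> k) = length (fst (state_at \<mu> k)) - 1"
proof -
  have adm: "admissible I (start I J) (take k \<mu>)"
    using assms admissible_take by (simp add: accepted_def)
  have "fst (state_at \<mu> k) \<noteq> []"
    using wf_run[OF finite_I wf_start adm] by (cases "state_at \<mu> k") auto
  then obtain i s where "fst (state_at \<mu> k) = i # s" by (cases "fst (state_at \<mu> k)") auto
  then show ?thesis
    using run_start[OF adm] by (auto simp: path_point_def horiz_nu)
qed

text \<open>The heights are positive, so subtracting one in \<open>horiz_state_at\<close> keeps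
  different heights different.\<close>

lemma horiz_eq_iff:
  assumes "accepted I (start I J) \<mu>"
  shows "horiz (nu_path I J) (path_point \<mu> k) = horiz (nu_path I J) (path_point \<mu> l) \<longleftrightarrow>
    length (fst (state_at \<mu> k)) = length (fst (state_at \<mu> l))"
proof -
  have "0 < length (fst (state_at \<mu> k))" for k
    using wf_state_at[of \<mu> k] assms by (cases "state_at \<mu> k") (auto simp: accepted_def)
  then have "Suc (length (fst (state_at \<mu> k)) - 1) = length (fst (state_at \<mu> k))" for k by simp
  then show ?thesis unfolding horiz_state_at[OF assms] by metis
qed


section \<open>Flips and Tamari moves\<close>

text \<open>Split \<mu> at the valley as \<open>u\<close>, East, \<open>North # v\<close>,
  \<open>w\<close>, where \<open>v\<close> ends at the partner point. Delaying the east step keeps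
  \<open>i'\<close> on the stack during \<open>North # v\<close>: the arc \<open>(i, j)\<close> of
  the valley is lost, and \<open>(i', j')\<close> is gained just before the delayed step. The other
  two corners \<open>(i', j)\<close> and \<open>(i, j')\<close> lie in the tree of \<mu>; they serve
  the uniqueness of flips.\<close>

lemma move_of_arcs:
  assumes acc: "accepted I (start I J) \<mu>"
    and val: "valley \<mu> k" and kl: "k < l" "l \<le> length \<mu>"
    and eq: "length (fst (state_at \<mu> l)) = length (fst (state_at \<mu> k))"
    and neq: "\<forall>m. k < m \<and> m < l \<longrightarrow> length (fst (state_at \<mu> m)) \<noteq> length (fst (state_at \<mu> k))"
    and \<mu>': "\<mu>' = take (k - 1) \<mu> @ take (l - k) (drop k \<mu>) @ [East] @ drop l \<mu>"
  shows "\<exists>i j i' j'. cross (i, j) (i', j') \<and> arc (state_at \<mu> k) = (i, j) \<and>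
    (i', j) \<in> arcs I (start I J) \<mu> \<and> (i, j') \<in> arcs I (start I J) \<mu> \<and>
    accepted I (start I J) \<mu>' \<and>
    insert (i', j') (arcs I (start I J) \<mu>) = insert (i, j) (arcs I (start I J) \<mu>')"
proof -
  let ?\<sigma>0 = "start I J"
  define u where "u = take (k - 1) \<mu>"
  define v where "v = take (l - k - 1) (drop (Suc k) \<mu>)"
  define w where "w = drop l \<mu>"
  have k: "0 < k" "k < length \<mu>" "\<mu> ! (k - 1) = East" "\<mu> ! k = North"
    using val by (auto simp: valley_def)
  have tk: "take k \<mu> = u @ [East]"
    using k take_Suc_conv_app_nth[of "k - 1" \<mu>] by (simp add: u_def)
  have "drop k \<mu> = North # drop (Suc k) \<mu>" using k Cons_nth_drop_Suc[of k \<mu>] by simp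
  moreover have "Suc (l - k - 1) = l - k" using kl by simp
  ultimately have mid: "take (l - k) (drop k \<mu>) = North # v"
    unfolding v_def by (metis take_Suc_Cons)
  have "take (l - k) (drop k \<mu>) @ drop (l - k) (drop k \<mu>) = drop k \<mu>" by (rule append_take_drop_id)
  then have "drop k \<mu> = (North # v) @ w" using kl mid by (simp add: w_def)
  then have split: "\<mu> = u @ East # North # v @ w"
    using append_take_drop_id[of k \<mu>] tk by simp
  have len: "l = k + Suc (length v)" using kl by (simp add: v_def)
  have lu: "length u = k - 1" using k by (simp add: u_def)
  have take_at: "take (k + m) \<mu> = u @ East # take m (North # v)" if "m \<le> Suc (length v)" for m
  proof -
    have "k + m - length u = Suc m" using lu k by simp
    then show ?thesis using that lu k by (subst split) (cases m; simp)
  qed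
  have adm_u: "admissible I ?\<sigma>0 u" and en: "enabled East (run I ?\<sigma>0 u)"
    and acc': "accepted I (advance I East (run I ?\<sigma>0 u)) (North # v @ w)"
    using acc unfolding split accepted_append accepted_simps by auto
  obtain s r where \<sigma>u: "run I ?\<sigma>0 u = (s, r)" by (cases "run I ?\<sigma>0 u")
  \<comment> \<open>\<open>i'\<close> is the vertex popped just before the valley and
    \<open>i\<close> the one uncovered there.\<close>
  then obtain i' i s' where s: "s = i' # i # s'" using en by (cases s; cases "tl s") auto
  have wf: "wf_state (s, r)" using wf_run[OF finite_I wf_start adm_u] \<sigma>u by simp
  have at: "state_at \<mu> (k + m) = run I (i # s', r) (take m (North # v))" if "m \<le> Suc (length v)" for m
    using take_at[OF that] \<sigma>u s by simp
  have at_k: "state_at \<mu> k = (i # s', r)" using at[of 0] by simp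
  have at_l: "state_at \<mu> l = run I (i # s', r) (North # v)" using at[of "Suc (length v)"] len by simp
  \<comment> \<open>The delayed path runs \<open>North # v\<close> on the stack \<open>s\<close>
    that still has \<open>i'\<close>, the original one on \<open>i # s'\<close>. In between, neither
    run looks at its bottom.\<close>
  have "\<exists>r' X. run I (i # s', r) (North # v) = (i # s', r') \<and> run I (s, r) (North # v) = (s, r') \<and>
    trail I (i # s', r) (North # v) = insert (arc (i # s', r)) X \<and>
    trail I (s, r) (North # v) = insert (arc (s, r)) X \<and>
    (admissible I (s, r) (North # v) \<longleftrightarrow> admissible I (i # s', r) (North # v))"
  proof (rule run_North_replace_bottom)
    show "length (fst (run I (i # s', r) (take (Suc m) (North # v)))) \<noteq> length (i # s')"
      if "m < length v" for m
      using neq[rule_format, of "k + Suc m"] that len at[of "Suc m"] at_k by simp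
    show "length (fst (run I (i # s', r) (North # v))) = length (i # s')"
      using eq at_k at_l by simp
  qed (use s in auto)
  then obtain r' X where r': "run I (i # s', r) (North # v) = (i # s', r')"
      "run I (s, r) (North # v) = (s, r')"
    and X: "trail I (i # s', r) (North # v) = insert (arc (i # s', r)) X"
      "trail I (s, r) (North # v) = insert (arc (s, r)) X"
    and adm: "admissible I (s, r) (North # v) \<longleftrightarrow> admissible I (i # s', r) (North # v)"
    by blast
  have "accepted I (i # s', r) ((North # v) @ w)" using acc' \<sigma>u s by simp
  then have acc_v: "admissible I (i # s', r) (North # v)" and acc_w: "accepted I (i # s', r') w"
    unfolding accepted_append r' by auto
  have \<mu>'_eq: "\<mu>' = u @ (North # v) @ East # w"
    unfolding \<mu>' mid u_def[symmetric] w_def[symmetric] by simp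
  have accepted': "accepted I ?\<sigma>0 \<mu>'"
    unfolding \<mu>'_eq accepted_append \<sigma>u r' accepted_simps using adm_u adm acc_v acc_w s by simp
  have arcs: "arcs I ?\<sigma>0 \<mu> = trail I ?\<sigma>0 u \<union>
      insert (arc (s, r)) (insert (arc (i # s', r)) X \<union> arcs I (i # s', r') w)"
  proof -
    have "\<mu> = u @ East # ((North # v) @ w)" using split by simp
    moreover have "advance I East (s, r) = (i # s', r)" using s by simp
    ultimately show ?thesis by (simp only: arcs_append arcs_simps(2) \<sigma>u X r')
  qed
  have "arcs I (s, r') (East # w) = insert (arc (s, r')) (arcs I (i # s', r') w)" using s by simp
  then have arcs': "arcs I ?\<sigma>0 \<mu>' = trail I ?\<sigma>0 u \<union>
      (insert (arc (s, r)) X \<union> insert (arc (s, r')) (arcs I (i # s', r') w))"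
    unfolding \<mu>'_eq arcs_append \<sigma>u X r' by simp
  \<comment> \<open>The middle part starts with a north step, so it passes at least one barred
    vertex.\<close>
  have "hd r < hd r'"
  proof -
    have rne: "r \<noteq> []" and srt: "sorted_wrt (<) r" using wf by auto
    have "r' = drop (count_list (North # v) North) r"
      using snd_run[of I "(i # s', r)" "North # v"] r' by simp
    then have "set r' \<subseteq> set (tl r)"
      using set_drop_subset[of "count_list v North" "tl r"] by (simp add: drop_Suc)
    moreover have "r' \<noteq> []"
    proof -
      have "wf_state (i # s', r)" using wf s by auto
      then have "wf_state (i # s', r')" using wf_run[OF finite_I _ acc_v] r' by simp
      then show ?thesis by simp
    qed
    ultimately have "hd r' \<in> set (tl r)" using hd_in_set by blast
    then show ?thesis using rne srt by (cases r) auto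
  qed
  moreover have "i < i'" "i' \<le> hd r" using wf s by auto
  ultimately have "cross (i, hd r) (i', hd r')" by simp
  moreover have "arc (state_at \<mu> k) = (i, hd r)" using at_k by simp
  moreover have "(i', hd r) \<in> arcs I ?\<sigma>0 \<mu>" unfolding arcs using s by simp
  moreover have "(i, hd r') \<in> arcs I ?\<sigma>0 \<mu>"
    unfolding arcs using arc_in_arcs[of "(i # s', r')" I w] by simp
  moreover have "insert (i', hd r') (arcs I ?\<sigma>0 \<mu>) = insert (i, hd r) (arcs I ?\<sigma>0 \<mu>')"
    unfolding arcs arcs' using s by auto
  ultimately show ?thesis using accepted' by blast
qed

lemma Tamari_move_iff:
  assumes "accepted I (start I J) \<mu>"
  shows "Tamari_move (nu_path I J) \<mu> \<mu>' \<longleftrightarrow>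
    (\<exists>k l. valley \<mu> k \<and> k < l \<and> l \<le> length \<mu> \<and>
      length (fst (state_at \<mu> l)) = length (fst (state_at \<mu> k)) \<and>
      (\<forall>m. k < m \<and> m < l \<longrightarrow> length (fst (state_at \<mu> m)) \<noteq> length (fst (state_at \<mu> k))) \<and>
      \<mu>' = take (k - 1) \<mu> @ take (l - k) (drop k \<mu>) @ [East] @ drop l \<mu>)"
  using assms unfolding Tamari_move_def Dyck_path_iff horiz_eq_iff[OF assms] by simp

lemma arcs_max: "accepted I (start I J) \<mu> \<Longrightarrow>
    max_noncrossing {(i, j). i \<in> I \<and> j \<in> J \<and> i \<le> j} (arcs I (start I J) \<mu>)"
  using arcs_max_noncrossing[OF finite_I wf_start] by (simp add: ground_start)

lemma move_imp_flip:
  assumes acc: "accepted I (start I J) \<mu>" and move: "Tamari_move (nu_path I J) \<mu> \<mu>'"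
  shows "increasing_flip I J (arcs I (start I J) \<mu>) (arcs I (start I J) \<mu>')"
proof -
  obtain k l where kl: "valley \<mu> k" "k < l" "l \<le> length \<mu>"
      "length (fst (state_at \<mu> l)) = length (fst (state_at \<mu> k))"
      "\<forall>m. k < m \<and> m < l \<longrightarrow> length (fst (state_at \<mu> m)) \<noteq> length (fst (state_at \<mu> k))"
      "\<mu>' = take (k - 1) \<mu> @ take (l - k) (drop k \<mu>) @ [East] @ drop l \<mu>"
    using move unfolding Tamari_move_iff[OF acc] by blast
  let ?T = "arcs I (start I J) \<mu>" let ?T' = "arcs I (start I J) \<mu>'"
  obtain i j i' j' where cr: "cross (i, j) (i', j')" and arc: "arc (state_at \<mu> k) = (i, j)"
    and acc': "accepted I (start I J) \<mu>'" and eq: "insert (i', j') ?T = insert (i, j) ?T'"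
    using move_of_arcs[OF acc kl] by (elim exE conjE) (rule that)
  have "arc (state_at \<mu> k) \<in> ?T"
    unfolding arcs_conv_take using kl(2,3) by (intro imageI) simp
  then have "(i, j) \<in> ?T" unfolding arc .
  moreover have ne: "(i, j) \<noteq> (i', j')" using cr by auto
  moreover have "?T' = (?T - {(i, j)}) \<union> {(i', j')}"
    by (rule exchange_eq[OF eq cr max_noncrossingD(2)[OF arcs_max[OF acc']]])
  moreover have "IJ_tree I J ?T" "IJ_tree I J ?T'" 
    unfolding IJ_tree_iff using arcs_max acc acc' by simp_all
  moreover have "i' > i" "j' > j" using cr by auto
  ultimately show ?thesis
    unfolding increasing_flip_def
    by (intro conjI exI[of _ i] exI[of _ j] exI[of _ i'] exI[of _ j'])
qed

text \<open>The arcs \<open>(i0, j)\<close> and \<open>(i, j0)\<close> confine \<open>x\<close> to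
  the rectangle spanned by \<open>a\<close> and \<open>(i0, j0)\<close>. If \<open>x\<close>
  differed from \<open>(i0, j0)\<close>, maximality would put it strictly inside, and then
  \<open>(i', j)\<close> could be neither in \<open>T\<close> nor crossed by an arc of
  \<open>T\<close>.\<close>

lemma flip_unique:
  assumes T: "max_noncrossing {(i, j). i \<in> I \<and> j \<in> J \<and> i \<le> j} T"
    and T': "max_noncrossing {(i, j). i \<in> I \<and> j \<in> J \<and> i \<le> j} ((T - {a}) \<union> {x})"
    and T'': "max_noncrossing {(i, j). i \<in> I \<and> j \<in> J \<and> i \<le> j} ((T - {a}) \<union> {(i0, j0)})"
    and a: "a = (i, j)" "a \<in> T" and cr: "cross a x" "cross a (i0, j0)"
    and corner: "(i0, j) \<in> T" "(i, j0) \<in> T"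
  shows "x = (i0, j0)"
proof (rule ccontr)
  assume ne: "x \<noteq> (i0, j0)"
  obtain i' j' where x: "x = (i', j')" by (cases x)
  have c: "i < i'" "i' \<le> j" "j < j'" "i < i0" "i0 \<le> j" "j < j0" using cr a x by auto
  have "\<not> cross (i0, j) x" "\<not> cross (i, j0) x"
    using corner max_noncrossingD(2)[OF T', of _ x] c a by auto
  then have le: "i' \<le> i0" "j' \<le> j0" using c x by auto
  have "(i0, j0) \<notin> T" using max_noncrossingD(2)[OF T a(2)] cr(2) by blast
  then have notin: "(i0, j0) \<notin> (T - {a}) \<union> {x}" using ne by auto
  have y: "(i0, j0) \<in> {(i, j). i \<in> I \<and> j \<in> J \<and> i \<le> j}"
    using max_noncrossingD(1)[OF T''] by blast
  \<comment> \<open>Maximality of the tree with \<open>x\<close> yields an arc crossing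
    \<open>(i0, j0)\<close>; the common arcs lie also in the other tree, so only \<open>x\<close> is
    left.\<close>
  obtain q where q: "q \<in> (T - {a}) \<union> {x}" "cross (i0, j0) q \<or> cross q (i0, j0)"
    using max_noncrossingD(3)[OF T' y] notin by blast
  have "q = x"
    using q max_noncrossingD(2)[OF T'', of q "(i0, j0)"] max_noncrossingD(2)[OF T'', of "(i0, j0)" q]
    by blast
  then have c': "i' < i0" "j' < j0" using q le x by auto
  have z: "(i', j) \<in> {(i, j). i \<in> I \<and> j \<in> J \<and> i \<le> j}"
    using max_noncrossingD(1)[OF T'] max_noncrossingD(1)[OF T] a x c by auto
  \<comment> \<open>\<open>(i', j)\<close> would cross \<open>(i0, j0)\<close>, yet an arc of
    \<open>T\<close> that crosses \<open>(i', j)\<close> would also cross \<open>a\<close> or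
    \<open>x\<close>.\<close>
  have "(i', j) \<notin> T"
    using max_noncrossingD(2)[OF T'', of "(i', j)" "(i0, j0)"] a c c' by auto
  then obtain p where p: "p \<in> T" "cross (i', j) p \<or> cross p (i', j)"
    using max_noncrossingD(3)[OF T z] by blast
  obtain b d where bd: "p = (b, d)" by (cases p)
  have "\<not> cross a p" using max_noncrossingD(2)[OF T a(2) p(1)] .
  then have "b < i'" "i' \<le> d" "d < j" using p(2) bd a c by auto
  then have "cross p x" "p \<noteq> a" using bd x c a by auto
  then show False using max_noncrossingD(2)[OF T', of p x] p(1) by blast
qed

text \<open>An east step after the point would give an arc \<open>(c, j)\<close> with
  \<open>c < i\<close> that also crosses the new arc. On the other side, \<open>(i', j)\<close> is
  in the tree and comes earlier in the row of \<open>j\<close>, so the step before the point is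
  East.\<close>

lemma flip_arc_is_valley:
  assumes acc: "accepted I (start I J) \<mu>" and k: "k \<le> length \<mu>" "arc (state_at \<mu> k) = (i, j)"
    and x: "i' \<in> I" "j' \<in> J" "cross (i, j) (i', j')"
    and nc: "\<And>q. q \<in> arcs I (start I J) \<mu> \<Longrightarrow> q \<noteq> (i, j) \<Longrightarrow> \<not> cross q (i', j')"
  shows "valley \<mu> k"
proof -
  let ?T = "arcs I (start I J) \<mu>"
  note T = max_noncrossingD[OF arcs_max[OF acc]]
  have adm: "admissible I (start I J) \<mu>" using acc by (simp add: accepted_def)
  have inT: "arc (state_at \<mu> m) \<in> ?T" if "m \<le> length \<mu>" for m
    unfolding arcs_conv_take using that by (intro imageI) simp
  have ijT: "(i, j) \<in> ?T" using inT[OF k(1)] k(2) by simp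
  obtain s r where \<sigma>: "state_at \<mu> k = (s, r)" by (cases "state_at \<mu> k")
  have wf: "wf_state (s, r)" using wf_state_at[OF adm, of k] \<sigma> by simp
  have hd: "hd s = i" "hd r = j" using k(2) \<sigma> by auto
  have ji: "i < i'" "i' \<le> j" "j < j'" using x(3) by auto
  \<comment> \<open>The row of \<open>j\<close> is not the last one, since \<open>j'\<close> lies
    beyond \<open>j\<close>.\<close>
  have "k \<noteq> length \<mu>"
  proof
    assume "k = length \<mu>"
    moreover have "count_list \<mu> North = card J - 1"
      using acc final_run_start_iff[OF adm] by (simp add: accepted_def)
    ultimately have "r = drop (card J - 1) (sorted_list_of_set J)"
      using snd_run_start[of \<mu>] \<sigma> by simp
    then have "hd r = Max J" using card_J_pos last_sorted_J by (simp add: hd_drop_conv_nth)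
    then show False using hd(2) ji(3) Max_ge[OF finite_J x(2)] by simp
  qed
  then have kl: "k < length \<mu>" using k(1) by simp
  have next_state: "state_at \<mu> (Suc m) = advance I (\<mu> ! m) (state_at \<mu> m)"
    and next_enabled: "enabled (\<mu> ! m) (state_at \<mu> m)" if "m < length \<mu>" for m
    using that admissible_take[OF adm, of "Suc m"] by (auto simp: take_Suc_conv_app_nth)
  have north: "\<mu> ! k = North"
  proof (rule ccontr)
    assume "\<mu> ! k \<noteq> North"
    then have E: "\<mu> ! k = East" by (cases "\<mu> ! k") auto
    obtain c s' where s: "s = i # c # s'"
      using next_enabled[OF kl] E \<sigma> hd(1) by (cases s; cases "tl s") auto
    have "arc (state_at \<mu> (Suc k)) = (c, j)" using next_state[OF kl] E \<sigma> s hd(2) by simp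
    then have "(c, j) \<in> ?T" using inT[of "Suc k"] kl by simp
    moreover have "c < i" using wf s by simp
    ultimately show False using nc[of "(c, j)"] ji by simp
  qed
  \<comment> \<open>Any arc of the tree crossing \<open>(i', j)\<close> would also cross
    \<open>(i, j)\<close> or the new arc, so maximality applies.\<close>
  have "(i', j) \<in> ?T"
  proof (rule ccontr)
    assume nT: "(i', j) \<notin> ?T"
    have "(i', j) \<in> {(i, j). i \<in> I \<and> j \<in> J \<and> i \<le> j}" using ijT T(1) x(1) ji by auto
    then obtain q where q: "q \<in> ?T" "cross (i', j) q \<or> cross q (i', j)" using T(3) nT by blast
    obtain b d where bd: "q = (b, d)" by (cases q)
    have "\<not> cross (i, j) q" using T(2)[OF ijT q(1)] .
    then have "b < i'" "i' \<le> d" "d < j" using q(2) bd ji by auto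
    then show False using nc[OF q(1)] bd ji by auto
  qed
  then obtain m where m: "m \<le> length \<mu>" "arc (state_at \<mu> m) = (i', j)"
    unfolding arcs_conv_take by (metis (no_types, lifting) atMost_iff imageE)
  \<comment> \<open>From time \<open>k\<close> on, all plain ends are at most \<open>i\<close> or
    beyond \<open>j\<close>, and \<open>i'\<close> is neither.\<close>
  have "m < k"
  proof (rule ccontr)
    assume "\<not> m < k"
    then have "(i', j) \<in> ground I (s, r)"
      using arc_take_in_ground[OF finite_I wf_start adm, of k m] m \<sigma> by simp
    then have "i' \<in> set s" using hd ji by auto
    then show False using wf hd(1) ji(1) by (cases s) auto
  qed
  \<comment> \<open>A north step would start the row of \<open>j\<close> at time \<open>k\<close>,
    but \<open>m < k\<close> is already in that row.\<close>
  moreover have "\<mu> ! (k - 1) = East"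
  proof (rule ccontr)
    assume "\<mu> ! (k - 1) \<noteq> East"
    then have N: "\<mu> ! (k - 1) = North" by (cases "\<mu> ! (k - 1)") auto
    have k1: "k - 1 < length \<mu>" "Suc (k - 1) = k" using \<open>m < k\<close> k(1) by auto
    obtain s1 r1 where \<sigma>1: "state_at \<mu> (k - 1) = (s1, r1)" by (cases "state_at \<mu> (k - 1)")
    have "r = tl r1" using next_state[OF k1(1)] N \<sigma>1 \<sigma> k1(2) by simp
    moreover have "2 \<le> length r1" using next_enabled[OF k1(1)] N \<sigma>1 by simp
    moreover have "wf_state (s1, r1)" using wf_state_at[OF adm, of "k - 1"] \<sigma>1 by simp
    ultimately have "hd r1 < j" using hd(2) by (cases r1; cases "tl r1") auto
    obtain s2 r2 where \<sigma>2: "state_at \<mu> m = (s2, r2)" by (cases "state_at \<mu> m")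
    have "arc (s1, r1) \<in> ground I (s2, r2)"
      using arc_take_in_ground[OF finite_I wf_start adm, of m "k - 1"] \<open>m < k\<close> k1(1) \<sigma>1 \<sigma>2 by simp
    then have "hd r1 \<in> set r2" by simp
    moreover have "wf_state (s2, r2)" using wf_state_at[OF adm, of m] \<sigma>2 by simp
    moreover have "hd r2 = j" using m(2) \<sigma>2 by simp
    ultimately have "j \<le> hd r1" by (cases r2) auto
    then show False using \<open>hd r1 < j\<close> by simp
  qed
  ultimately show ?thesis using kl north by (simp add: valley_def)
qed

text \<open>The north step does not lower the stack, which ends at height one, so the height of the
  valley recurs; the least such time is the partner.\<close>

lemma valley_has_partner:
  assumes acc: "accepted I (start I J) \<mu>" and val: "valley \<mu> k"
  shows "\<exists>l. k < l \<and> l \<le> length \<mu> \<and>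
    length (fst (state_at \<mu> l)) = length (fst (state_at \<mu> k)) \<and>
    (\<forall>m. k < m \<and> m < l \<longrightarrow> length (fst (state_at \<mu> m)) \<noteq> length (fst (state_at \<mu> k)))"
proof -
  let ?h = "\<lambda>m. length (fst (state_at \<mu> m))"
  let ?P = "\<lambda>l. k < l \<and> l \<le> length \<mu> \<and> ?h l = ?h k"
  have k: "k < length \<mu>" "\<mu> ! k = North" using val by (auto simp: valley_def)
  have "state_at \<mu> (Suc k) = advance I North (state_at \<mu> k)"
    using k by (simp add: take_Suc_conv_app_nth)
  then have up: "?h k \<le> ?h (Suc k)" by (cases "state_at \<mu> k") simp
  have runs: "run I (state_at \<mu> (Suc k)) (take m (drop (Suc k) \<mu>)) = state_at \<mu> (Suc k + m)" for m
    unfolding take_add by simp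
  have "state_at \<mu> k \<noteq> ([], r)" for r
    using wf_state_at[of \<mu> k] acc by (auto simp: accepted_def)
  then have "1 \<le> ?h k" by (cases "state_at \<mu> k") (auto simp: Suc_le_eq)
  moreover have "length (fst (run I (start I J) \<mu>)) = 1"
    using acc by (cases "run I (start I J) \<mu>") (auto simp: accepted_def)
  ultimately have "length (fst (run I (state_at \<mu> (Suc k)) (drop (Suc k) \<mu>))) \<le> ?h k"
    by (simp flip: run_append)
  then obtain m where "m \<le> length (drop (Suc k) \<mu>)" "?h (Suc k + m) = ?h k"
    using stack_height_reached[OF up, of I "drop (Suc k) \<mu>"] unfolding runs by blast
  then have "?P (Suc k + m)" using k by simp
  then have "?P (LEAST l. ?P l)" by (rule LeastI)
  moreover have "\<not> ?P m" if "m < (LEAST l. ?P l)" for m using not_less_Least[OF that] .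
  ultimately show ?thesis by (intro exI[of _ "LEAST l. ?P l"]) auto
qed

text \<open>The flipped arc marks a valley, the Tamari move there flips the same arc, and
  \<open>flip_unique\<close> makes the two resulting trees equal. Then \<rho> recovers the
  path.\<close>

lemma flip_imp_move:
  assumes acc: "accepted I (start I J) \<mu>" "accepted I (start I J) \<mu>'"
    and flip: "increasing_flip I J (arcs I (start I J) \<mu>) (arcs I (start I J) \<mu>')"
  shows "Tamari_move (nu_path I J) \<mu> \<mu>'"
proof -
  let ?T = "arcs I (start I J) \<mu>" let ?T' = "arcs I (start I J) \<mu>'"
  note T = max_noncrossingD[OF arcs_max[OF acc(1)]]
  note T' = max_noncrossingD[OF arcs_max[OF acc(2)]]
  obtain i j i' j' where ij: "(i, j) \<in> ?T" "(i, j) \<noteq> (i', j')" "i < i'" "j < j'"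
    and T'_eq: "?T' = (?T - {(i, j)}) \<union> {(i', j')}"
    using flip unfolding increasing_flip_def by (elim conjE exE) (rule that)
  have xT': "(i', j') \<in> ?T'" unfolding T'_eq by simp
  have ijT': "(i, j) \<notin> ?T'" unfolding T'_eq using ij(2) by simp
  \<comment> \<open>The removed arc is missing from the maximal set \<open>?T'\<close>, so some arc
    there crosses it, and that can only be the new one.\<close>
  obtain q where q: "q \<in> ?T'" "cross (i, j) q \<or> cross q (i, j)"
    using T'(3)[OF subsetD[OF T(1) ij(1)]] ijT' by metis
  have "q \<notin> ?T" using q(2) T(2)[OF ij(1), of q] T(2)[OF _ ij(1), of q] by metis
  then have "q = (i', j')" using q(1) unfolding T'_eq by simp
  then have cr: "cross (i, j) (i', j')" using q(2) ij(3) by auto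
  have "\<not> cross q (i', j')" if "q \<in> ?T" "q \<noteq> (i, j)" for q
  proof -
    have "q \<in> ?T'" unfolding T'_eq using that by simp
    then show ?thesis using T'(2)[OF _ xT'] by simp
  qed
  moreover have "i' \<in> I" "j' \<in> J" using subsetD[OF T'(1) xT'] by auto
  moreover obtain k where k: "k \<le> length \<mu>" "arc (state_at \<mu> k) = (i, j)"
    using ij(1) unfolding arcs_conv_take by (metis (no_types, lifting) atMost_iff imageE)
  ultimately have val: "valley \<mu> k" using flip_arc_is_valley[OF acc(1) k _ _ cr] by simp
  obtain l where l: "k < l" "l \<le> length \<mu>" "length (fst (state_at \<mu> l)) = length (fst (state_at \<mu> k))"
      "\<forall>m. k < m \<and> m < l \<longrightarrow> length (fst (state_at \<mu> m)) \<noteq> length (fst (state_at \<mu> k))"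
    using valley_has_partner[OF acc(1) val] by blast
  define \<mu>'' where "\<mu>'' = take (k - 1) \<mu> @ take (l - k) (drop k \<mu>) @ [East] @ drop l \<mu>"
  have move: "Tamari_move (nu_path I J) \<mu> \<mu>''"
    unfolding Tamari_move_iff[OF acc(1)]
    by (intro exI[of _ k] exI[of _ l] conjI val l \<mu>''_def)
  let ?T'' = "arcs I (start I J) \<mu>''"
  obtain a b i0 j0 where cr0: "cross (a, b) (i0, j0)" and arc0: "arc (state_at \<mu> k) = (a, b)"
    and corner: "(i0, b) \<in> ?T" "(a, j0) \<in> ?T"
    and acc'': "accepted I (start I J) \<mu>''" and eq: "insert (i0, j0) ?T = insert (a, b) ?T''"
    using move_of_arcs[OF acc(1) val l \<mu>''_def] by (elim exE conjE) (rule that)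
  have ab: "a = i" "b = j" using arc0 k(2) by auto
  have T''_eq: "?T'' = (?T - {(i, j)}) \<union> {(i0, j0)}"
    using exchange_eq[OF eq cr0 max_noncrossingD(2)[OF arcs_max[OF acc'']]] unfolding ab .
  have "(i', j') = (i0, j0)"
    by (rule flip_unique[OF arcs_max[OF acc(1)] arcs_max[OF acc(2), unfolded T'_eq]
          arcs_max[OF acc'', unfolded T''_eq] refl ij(1) cr cr0[unfolded ab] corner[unfolded ab]])
  then have "?T'' = ?T'" unfolding T'_eq T''_eq by simp
  then have "rho J ?T'' = rho J ?T'" by (rule arg_cong)
  then have "\<mu>'' = \<mu>'" unfolding rho_arcs[OF acc''] rho_arcs[OF acc(2)] .
  then show ?thesis using move by (rule subst)
qed

text \<open>Forming the arcs of a path is the inverse map.\<close>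

lemma bij_rho: "bij_betw (rho J) {T. IJ_tree I J T} {\<mu>. Dyck_path (nu_path I J) \<mu>}"
  by (rule bij_betw_byWitness[where f' = "arcs I (start I J)"])
    (auto simp: IJ_tree_iff_arcs Dyck_path_iff rho_arcs)

lemma flip_iff_move:
  assumes "IJ_tree I J T" "IJ_tree I J T'"
  shows "increasing_flip I J T T' \<longleftrightarrow> Tamari_move (nu_path I J) (rho J T) (rho J T')"
proof -
  obtain \<mu> where \<mu>: "accepted I (start I J) \<mu>" "T = arcs I (start I J) \<mu>"
    using assms(1) unfolding IJ_tree_iff_arcs by blast
  obtain \<mu>' where \<mu>': "accepted I (start I J) \<mu>'" "T' = arcs I (start I J) \<mu>'"
    using assms(2) unfolding IJ_tree_iff_arcs by blast
  show ?thesis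
    unfolding \<mu>(2) \<mu>'(2) rho_arcs[OF \<mu>(1)] rho_arcs[OF \<mu>'(1)]
    using flip_imp_move[OF \<mu>(1) \<mu>'(1)] move_imp_flip[OF \<mu>(1)] by blast
qed


section \<open>The two posets\<close>

lemma finite_IJ_tree: "IJ_tree I J T \<Longrightarrow> finite T"
  unfolding IJ_tree_iff max_noncrossing_def
  by (rule finite_subset[of _ "I \<times> J"]) (use finite_I finite_J in auto)

text \<open>The sum of all ends of the arcs is a strict potential for flips, which gives
  antisymmetry of the order.\<close>

lemma flip_increases_weight:
  assumes "increasing_flip I J T T'"
  shows "(\<Sum>(i, j) \<in> T. i + j) < (\<Sum>(i, j) \<in> T'. i + j)"
proof -
  have fin: "finite T" "finite T'"
    using assms finite_IJ_tree unfolding increasing_flip_def by blast+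
  obtain i j i' j' where ij: "(i, j) \<in> T" "i < i'" "j < j'"
    and T': "T' = (T - {(i, j)}) \<union> {(i', j')}"
    using assms unfolding increasing_flip_def by (elim conjE exE) (rule that)
  \<comment> \<open>Otherwise \<open>T'\<close> would be a proper subset of \<open>T\<close>,
    against its maximality.\<close>
  have "(i', j') \<notin> T"
  proof
    assume "(i', j') \<in> T"
    then have "T' \<subseteq> T" "(i, j) \<notin> T'" using T' ij by auto
    then show False
      using assms ij(1) unfolding increasing_flip_def IJ_tree_def by blast
  qed
  then have "(\<Sum>(i, j) \<in> T'. i + j) = (i' + j') + (\<Sum>(i, j) \<in> T - {(i, j)}. i + j)"
    unfolding T' using fin by simp
  moreover have "(\<Sum>(i, j) \<in> T. i + j) = (i + j) + (\<Sum>(i, j) \<in> T - {(i, j)}. i + j)"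
    using sum.remove[OF fin(1) ij(1), of "\<lambda>(i, j). i + j"] by simp
  ultimately show ?thesis using ij by simp
qed

lemma flips_increase_weight:
  assumes "(increasing_flip I J)\<^sup>*\<^sup>* T T'"
  shows "T = T' \<or> (\<Sum>(i, j) \<in> T. i + j) < (\<Sum>(i, j) \<in> T'. i + j)"
  using assms
proof induction
  case (step T' T'')
  then show ?case using flip_increases_weight[of T' T''] by (elim disjE) auto
qed simp

lemma partial_order_IJ: "partial_order_on {T. IJ_tree I J T} (IJ_Tamari_order I J)"
proof -
  have "antisym (IJ_Tamari_order I J)"
  proof (rule antisymI)
    fix T T' assume "(T, T') \<in> IJ_Tamari_order I J" "(T', T) \<in> IJ_Tamari_order I J"
    then show "T = T'"
      unfolding IJ_Tamari_order_def using flips_increase_weight[of T T'] flips_increase_weight[of T' T]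
      by (auto dest: less_asym)
  qed
  moreover have "trans (IJ_Tamari_order I J)"
    by (rule transI) (auto simp: IJ_Tamari_order_def elim: rtranclp_trans)
  ultimately show ?thesis
    unfolding partial_order_on_def preorder_on_def by (auto simp: IJ_Tamari_order_def refl_on_def)
qed

text \<open>Moves only leave from Dyck paths, so every intermediate path of a chain of moves is the
  image of a tree, and the chain lifts to flips.\<close>

lemma Tamari_order_iff:
  assumes "IJ_tree I J T" "IJ_tree I J T'"
  shows "(T, T') \<in> IJ_Tamari_order I J \<longleftrightarrow> (rho J T, rho J T') \<in> nu_Tamari_order (nu_path I J)"
proof -
  let ?\<nu> = "nu_path I J"
  have Dyck: "Dyck_path ?\<nu> (rho J S)" if "IJ_tree I J S" for S
    using bij_betwE[OF bij_rho] that by blast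
  have "(Tamari_move ?\<nu>)\<^sup>*\<^sup>* (rho J T) (rho J S)" if "(increasing_flip I J)\<^sup>*\<^sup>* T S" for S
    using that
  proof induction
    case (step S S')
    have "IJ_tree I J S" "IJ_tree I J S'"
      using step.hyps(2) unfolding increasing_flip_def by simp_all
    then have "Tamari_move ?\<nu> (rho J S) (rho J S')"
      using flip_iff_move step.hyps(2) by simp
    with step.IH show ?case by (rule rtranclp.rtrancl_into_rtrancl)
  qed simp
  moreover have "(increasing_flip I J)\<^sup>*\<^sup>* T S"
    if "(Tamari_move ?\<nu>)\<^sup>*\<^sup>* (rho J T) \<mu>" "IJ_tree I J S" "rho J S = \<mu>" for S \<mu>
    using that
  proof (induction arbitrary: S)
    case base
    have "S = T"
      by (rule inj_onD[OF bij_betw_imp_inj_on[OF bij_rho]]) (use base assms(1) in simp_all)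
    then show ?case by simp
  next
    case (step \<mu> \<mu>')
    then have "Dyck_path ?\<nu> \<mu>" by (simp add: Tamari_move_def)
    then have "\<mu> \<in> rho J ` {T. IJ_tree I J T}"
      unfolding bij_betw_imp_surj_on[OF bij_rho] by simp
    then obtain R where R: "IJ_tree I J R" "rho J R = \<mu>" by auto
    have "increasing_flip I J R S"
      unfolding flip_iff_move[OF R(1) step.prems(1)] R(2) step.prems(2) by (rule step.hyps(2))
    with step.IH[OF R] show ?case by (rule rtranclp.rtrancl_into_rtrancl)
  qed
  ultimately have "(increasing_flip I J)\<^sup>*\<^sup>* T T' \<longleftrightarrow>
      (Tamari_move ?\<nu>)\<^sup>*\<^sup>* (rho J T) (rho J T')"
    using assms(2) by metis
  then show ?thesis
    using assms Dyck by (simp add: IJ_Tamari_order_def nu_Tamari_order_def)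
qed

text \<open>Antisymmetry is carried over from the trees along the bijection.\<close>

lemma partial_order_nu: "partial_order_on {\<mu>. Dyck_path (nu_path I J) \<mu>} (nu_Tamari_order (nu_path I J))"
proof -
  have "antisym (nu_Tamari_order (nu_path I J))"
  proof (rule antisymI)
    fix \<mu> \<mu>' assume o: "(\<mu>, \<mu>') \<in> nu_Tamari_order (nu_path I J)" "(\<mu>', \<mu>) \<in> nu_Tamari_order (nu_path I J)"
    then have "Dyck_path (nu_path I J) \<mu>" "Dyck_path (nu_path I J) \<mu>'"
      unfolding nu_Tamari_order_def by auto
    then have "\<mu> \<in> rho J ` {T. IJ_tree I J T}" "\<mu>' \<in> rho J ` {T. IJ_tree I J T}"
      unfolding bij_betw_imp_surj_on[OF bij_rho] by simp_all
    then obtain T T' where T: "IJ_tree I J T" "rho J T = \<mu>" "IJ_tree I J T'" "rho J T' = \<mu>'"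
      by auto
    then have "(T, T') \<in> IJ_Tamari_order I J" "(T', T) \<in> IJ_Tamari_order I J"
      using o unfolding Tamari_order_iff[OF T(1,3)] Tamari_order_iff[OF T(3,1)] T(2,4) by simp_all
    moreover have "antisym (IJ_Tamari_order I J)"
      using partial_order_IJ by (simp add: partial_order_on_def)
    ultimately have "T = T'" by (rule antisymD[rotated])
    then show "\<mu> = \<mu>'" unfolding T(2)[symmetric] T(4)[symmetric] by simp
  qed
  moreover have "trans (nu_Tamari_order (nu_path I J))"
    by (rule transI) (auto simp: nu_Tamari_order_def elim: rtranclp_trans)
  ultimately show ?thesis
    unfolding partial_order_on_def preorder_on_def by (auto simp: nu_Tamari_order_def refl_on_def)
qed

end

theorem theorem3p4:
  fixes I J :: "nat set" and \<nu> :: path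
  assumes "finite I" and "I \<noteq> {}"
    and "finite J" and "J \<noteq> {}"
    and "Min (vertices I J) \<in> Plain ` I"
    and "Max (vertices I J) \<in> Bar ` J"
    and "\<nu> = nu_path I J"
  shows "(\<forall>T T'. IJ_tree I J T \<and> IJ_tree I J T' \<longrightarrow>
            (increasing_flip I J T T' \<longleftrightarrow> Tamari_move \<nu> (rho J T) (rho J T')))
       \<and> partial_order_on {T. IJ_tree I J T} (IJ_Tamari_order I J)
       \<and> partial_order_on {\<mu>. Dyck_path \<nu> \<mu>} (nu_Tamari_order \<nu>)
       \<and> bij_betw (rho J) {T. IJ_tree I J T} {\<mu>. Dyck_path \<nu> \<mu>}
       \<and> (\<forall>T T'. IJ_tree I J T \<and> IJ_tree I J T' \<longrightarrow>
            ((T, T') \<in> IJ_Tamari_order I J \<longleftrightarrow>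
             (rho J T, rho J T') \<in> nu_Tamari_order \<nu>))"
proof -
  interpret alternating_pair I J using assms by unfold_locales
  show ?thesis
    unfolding assms(7)
    using flip_iff_move partial_order_IJ partial_order_nu bij_rho Tamari_order_iff by simp
qed

end
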